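(* For every $\mathrm{TM}\in\{\text{TJ},\text{TS},\text{TAR}\}$, every $Z\in\{\text{DA},\text{G-DA},\text{OA},\text{G-OA},\text{Idp-OA},\text{PA},\text{G-PA}\}$ and every $p\in\{k,\ell\}$, the problem $Z$-Reconf-TM parameterized by $\mathsf{nd}(G)+p$ is fixed-parameter tractable, where $k$ is the number of tokens ($|A_s|=|A_t|$, resp. the size threshold for TAR) and $\ell$ is the upper bound on the length of the reconfiguration sequence (in the timed version).
   Context: Graphs are finite, simple, undirected. For $A\subseteq V$: $N[A]=A\cup\bigcup_{v\in A}N(v)$, $\partial A=N[A]\setminus A$, $d_A(v)=|N(v)\cap A|$. DA: $d_A(v)+1\ge d_{V\setminus A}(v)$ for all $v\in A$; OA: $d_A(v)\ge d_{V\setminus A}(v)+1$ for all $v\in\partial A$; PA: both; prefix G-: additionally dominating; Idp-OA: OA that is an independent set. Steps: token jumping (TJ): $|A|=|B|$, $|A\setminus B|=1$; token sliding (TS): TJ step with the vertex of $A\setminus B$ adjacent to the vertex of $B\setminus A$; token addition/removal (TAR): one set arises from the other by adding one vertex. $Z$-Reconf-TM: given $G$, sets $A_s,A_t$ with property $Z$ (and a threshold $k$ if TM$=$TAR), decide whether there is a sequence $A_s=A_1,\dots,A_m=A_t$ of sets with property $Z$ (of size at most $k$ if TM$=$TAR), consecutive sets differing by a TM step; in the timed version, a bound $\ell$ is also given and $m\le\ell$ is required. The neighborhood diversity $\mathsf{nd}(G)$ is the number of equivalence classes of the relation on $V$ where $u\sim v$ iff $N(u)\setminus\{v\}=N(v)\setminus\{u\}$.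 *)

theory Defs
  imports Main
begin

section \<open>Random access machines\<close>

text \<open>
  A random access machine on natural numbers with addition, cut-off subtraction, halving and
  indirect addressing, under the uniform cost measure (one time unit per instruction).  Since there
  is no multiplication, it is polynomially equivalent to Turing machines.
  Registers are numbered; \<open>Load i j\<close> sets \<open>R i := R (R j)\<close> and \<open>Store i j\<close> sets \<open>R (R i) := R j\<close>.
\<close>

datatype instr =
    Const nat nat
  | Add nat nat nat
  | Sub nat nat nat
  | Half nat nat
  | Load nat nat
  | Store nat nat
  | Jump nat
  | JumpZ nat nat

type_synonym config = "nat \<times> (nat \<Rightarrow> nat)"

fun exec :: "instr \<Rightarrow> config \<Rightarrow> config" where
  "exec (Const i c) (pc, R) = (Suc pc, R(i := c))"
| "exec (Add i j k) (pc, R) = (Suc pc, R(i := R j + R k))"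
| "exec (Sub i j k) (pc, R) = (Suc pc, R(i := R j - R k))"
| "exec (Half i j) (pc, R) = (Suc pc, R(i := R j div 2))"
| "exec (Load i j) (pc, R) = (Suc pc, R(i := R (R j)))"
| "exec (Store i j) (pc, R) = (Suc pc, R(R i := R j))"
| "exec (Jump l) (pc, R) = (l, R)"
| "exec (JumpZ i l) (pc, R) = (if R i = 0 then l else Suc pc, R)"

text \<open>The machine halts when the program counter leaves the program; it then stays put.\<close>

definition halted :: "instr list \<Rightarrow> config \<Rightarrow> bool" where
  "halted P c \<longleftrightarrow> length P \<le> fst c"

definition step :: "instr list \<Rightarrow> config \<Rightarrow> config" where
  "step P c = (if halted P c then c else exec (P ! fst c) c)"

definition halts_within :: "instr list \<Rightarrow> config \<Rightarrow> nat \<Rightarrow> nat \<Rightarrow> bool" where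
  "halts_within P c t out \<longleftrightarrow>
     halted P ((step P ^^ t) c) \<and> snd ((step P ^^ t) c) 0 = out"

definition computable :: "(nat \<Rightarrow> nat) \<Rightarrow> bool" where
  "computable f \<longleftrightarrow>
     (\<exists>P. \<forall>n. \<exists>t. halts_within P (0, (\<lambda>_. 0)(0 := n)) t (f n))"

section \<open>Fixed-parameter tractability\<close>

datatype symb = Bit bool | Sep

fun code :: "symb \<Rightarrow> nat" where
  "code (Bit b) = (if b then 1 else 0)"
| "code Sep = 2"

text \<open>Register 0 holds the length of the input word, registers 1, 2, \<open>\<dots>\<close> hold its letters.\<close>

definition input :: "symb list \<Rightarrow> config" where
  "input w = (0, \<lambda>i. if i = 0 then length w
                     else if i \<le> length w then code (w ! (i - 1)) else 0)"

text \<open>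
  A parameterized problem is given by its set \<open>I\<close> of instances, their encoding \<open>enc\<close> as words over
  a finite alphabet, the yes-instances and the parameter \<open>\<kappa>\<close>.  The deciding machine is uniform and
  is not told the value of the parameter.
\<close>

definition fpt :: "'i set \<Rightarrow> ('i \<Rightarrow> symb list) \<Rightarrow> ('i \<Rightarrow> bool) \<Rightarrow> ('i \<Rightarrow> nat) \<Rightarrow> bool" where
  "fpt I enc yes \<kappa> \<longleftrightarrow>
     (\<exists>P f c. computable f \<and>
        (\<forall>x\<in>I. halts_within P (input (enc x)) (f (\<kappa> x) * length (enc x) ^ c)
                 (if yes x then 1 else 0)))"

section \<open>Graphs and neighborhood diversity\<close>

definition sgraph :: "'a set \<Rightarrow> ('a \<Rightarrow> 'a \<Rightarrow> bool) \<Rightarrow> bool" where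
  "sgraph V E \<longleftrightarrow> finite V \<and> (\<forall>u v. E u v \<longrightarrow> u \<in> V \<and> v \<in> V \<and> u \<noteq> v \<and> E v u)"

definition nbrs :: "('a \<Rightarrow> 'a \<Rightarrow> bool) \<Rightarrow> 'a \<Rightarrow> 'a set" where
  "nbrs E v = {u. E v u}"

definition closed_nbrs :: "('a \<Rightarrow> 'a \<Rightarrow> bool) \<Rightarrow> 'a set \<Rightarrow> 'a set" where
  "closed_nbrs E A = A \<union> (\<Union>v\<in>A. nbrs E v)"

definition boundary :: "('a \<Rightarrow> 'a \<Rightarrow> bool) \<Rightarrow> 'a set \<Rightarrow> 'a set" where
  "boundary E A = closed_nbrs E A - A"

definition deg_in :: "('a \<Rightarrow> 'a \<Rightarrow> bool) \<Rightarrow> 'a set \<Rightarrow> 'a \<Rightarrow> nat" where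
  "deg_in E A v = card (nbrs E v \<inter> A)"

definition nd_rel :: "'a set \<Rightarrow> ('a \<Rightarrow> 'a \<Rightarrow> bool) \<Rightarrow> ('a \<times> 'a) set" where
  "nd_rel V E = {(u, v). u \<in> V \<and> v \<in> V \<and> nbrs E u - {v} = nbrs E v - {u}}"

definition nd :: "'a set \<Rightarrow> ('a \<Rightarrow> 'a \<Rightarrow> bool) \<Rightarrow> nat" where
  "nd V E = card (V // nd_rel V E)"

section \<open>Alliances\<close>

definition defensive :: "'a set \<Rightarrow> ('a \<Rightarrow> 'a \<Rightarrow> bool) \<Rightarrow> 'a set \<Rightarrow> bool" where
  "defensive V E A \<longleftrightarrow> (\<forall>v\<in>A. deg_in E A v + 1 \<ge> deg_in E (V - A) v)"

definition offensive :: "'a set \<Rightarrow> ('a \<Rightarrow> 'a \<Rightarrow> bool) \<Rightarrow> 'a set \<Rightarrow> bool" where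
  "offensive V E A \<longleftrightarrow> (\<forall>v\<in>boundary E A. deg_in E A v \<ge> deg_in E (V - A) v + 1)"

definition dominating :: "'a set \<Rightarrow> ('a \<Rightarrow> 'a \<Rightarrow> bool) \<Rightarrow> 'a set \<Rightarrow> bool" where
  "dominating V E A \<longleftrightarrow> closed_nbrs E A = V"

definition independent :: "('a \<Rightarrow> 'a \<Rightarrow> bool) \<Rightarrow> 'a set \<Rightarrow> bool" where
  "independent E A \<longleftrightarrow> (\<forall>u\<in>A. \<forall>v\<in>A. \<not> E u v)"

datatype alliance = DA | G_DA | OA | G_OA | Idp_OA | PA | G_PA

text \<open>The empty set is not excluded.\<close>

fun has_prop :: "alliance \<Rightarrow> 'a set \<Rightarrow> ('a \<Rightarrow> 'a \<Rightarrow> bool) \<Rightarrow> 'a set \<Rightarrow> bool" where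
  "has_prop DA V E A \<longleftrightarrow> A \<subseteq> V \<and> defensive V E A"
| "has_prop G_DA V E A \<longleftrightarrow> A \<subseteq> V \<and> defensive V E A \<and> dominating V E A"
| "has_prop OA V E A \<longleftrightarrow> A \<subseteq> V \<and> offensive V E A"
| "has_prop G_OA V E A \<longleftrightarrow> A \<subseteq> V \<and> offensive V E A \<and> dominating V E A"
| "has_prop Idp_OA V E A \<longleftrightarrow> A \<subseteq> V \<and> offensive V E A \<and> independent E A"
| "has_prop PA V E A \<longleftrightarrow> A \<subseteq> V \<and> defensive V E A \<and> offensive V E A"
| "has_prop G_PA V E A \<longleftrightarrow> A \<subseteq> V \<and> defensive V E A \<and> offensive V E A \<and> dominating V E A"

section \<open>Reconfiguration\<close>

datatype token_model = TJ | TS | TAR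

fun tstep :: "token_model \<Rightarrow> ('a \<Rightarrow> 'a \<Rightarrow> bool) \<Rightarrow> 'a set \<Rightarrow> 'a set \<Rightarrow> bool" where
  "tstep TJ E A B \<longleftrightarrow> card A = card B \<and> card (A - B) = 1"
| "tstep TS E A B \<longleftrightarrow> card A = card B \<and> card (A - B) = 1 \<and>
     (\<exists>u v. A - B = {u} \<and> B - A = {v} \<and> E u v)"
| "tstep TAR E A B \<longleftrightarrow>
     (\<exists>v. v \<notin> A \<and> B = insert v A) \<or> (\<exists>v. v \<notin> B \<and> A = insert v B)"

definition reconf_seq ::
    "alliance \<Rightarrow> token_model \<Rightarrow> 'a set \<Rightarrow> ('a \<Rightarrow> 'a \<Rightarrow> bool) \<Rightarrow> nat \<Rightarrow> 'a set \<Rightarrow> 'a set \<Rightarrow>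
     'a set list \<Rightarrow> bool" where
  "reconf_seq Z TM V E k As At xs \<longleftrightarrow>
     xs \<noteq> [] \<and> hd xs = As \<and> last xs = At \<and>
     (\<forall>A\<in>set xs. has_prop Z V E A \<and> (TM = TAR \<longrightarrow> card A \<le> k)) \<and>
     successively (tstep TM E) xs"

text \<open>
  Instances live on the vertex set \<open>{..<order x}\<close>.  The field \<open>thr\<close> is the threshold, used and
  encoded only for token addition/removal; \<open>len\<close> is the length bound, used and encoded only in the
  timed version.  If the start or target set lacks the required property, then there is no
  reconfiguration sequence and the instance is a no-instance.
\<close>

record reconf_inst =
  order :: nat
  adj :: "nat \<Rightarrow> nat \<Rightarrow> bool"
  src :: "nat set"
  tgt :: "nat set"
  thr :: nat
  len :: nat

definition instances :: "reconf_inst set" where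
  "instances = {x. sgraph {..<order x} (adj x) \<and> src x \<subseteq> {..<order x} \<and> tgt x \<subseteq> {..<order x}}"

definition reconf_yes :: "alliance \<Rightarrow> token_model \<Rightarrow> bool \<Rightarrow> reconf_inst \<Rightarrow> bool" where
  "reconf_yes Z TM timed x \<longleftrightarrow>
     (\<exists>xs. reconf_seq Z TM {..<order x} (adj x) (thr x) (src x) (tgt x) xs \<and>
           (timed \<longrightarrow> length xs \<le> len x))"

text \<open>Numbers are written in binary, least significant bit first.\<close>

fun bin :: "nat \<Rightarrow> symb list" where
  "bin n = (if n = 0 then [] else Bit (odd n) # bin (n div 2))"

declare bin.simps [simp del]

definition char_vec :: "nat \<Rightarrow> nat set \<Rightarrow> symb list" where
  "char_vec n A = map (\<lambda>i. Bit (i \<in> A)) [0..<n]"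

definition reconf_enc :: "token_model \<Rightarrow> bool \<Rightarrow> reconf_inst \<Rightarrow> symb list" where
  "reconf_enc TM timed x =
     char_vec (order x) (src x) @ [Sep] @ char_vec (order x) (tgt x) @ [Sep] @
     concat (map (\<lambda>i. char_vec (order x) (nbrs (adj x) i)) [0..<order x]) @
     (if TM = TAR then Sep # bin (thr x) else []) @
     (if timed then Sep # bin (len x) else [])"

datatype par = Tokens | Length

fun par_val :: "token_model \<Rightarrow> par \<Rightarrow> reconf_inst \<Rightarrow> nat" where
  "par_val TM Tokens x = (if TM = TAR then thr x else card (src x))"
| "par_val TM Length x = len x"

end

theory Submission
  imports Defs "HOL-Combinatorics.Transposition"
begin

text \<open>
  Refine the neighborhood classes by membership in the start and in the target set, and call a set
  canonical if it consists of initial segments of the refined classes.  The vertices of a refined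
  class are exchanged by automorphisms, so replacing every set of a reconfiguration sequence by the
  canonical set with the same number of tokens in each refined class preserves all properties in
  question; a step becomes a step or disappears, and the start and target sets are canonical.
  With parameter \<open>k\<close> (number of tokens or length), canonical sets along a sequence differ from the
  start set only at the first \<open>k\<close> and the last \<open>k\<close> vertices of each class, that is, at no more
  than \<open>8 * nd * k\<close> vertices.  Breadth-first search over the subsets of these vertices is polynomial
  in the number of these subsets and in the size of the input.

  Since the machine has unbounded registers at uniform cost, a set of states is kept as a
  single number, and the algorithm becomes a closed arithmetical expression, built from bounded
  sums and bounded quantifiers, over the input; no memory cell is ever written indirectly.
\<close>

section \<open>A compositional calculus for unit-cost running times\<close>

section \<open>Straight-line reasoning about machine code\<close>

text \<open>The obstacle on the machine side is storage: the word occupies registers 1, 2, ...,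
  exactly those that instructions can name, and no fixed register is free for all inputs. Hence the
  first \<open>K\<close> letters move into register 0 as base 4 digits behind the length. Running
  times are powers of a measure \<open>G\<close> of the input, and only the numbers of loop rounds
  must stay below such a power; values are left unbounded, since a set of \<open>2 ^ dim\<close>
  states is a number with \<open>2 ^ dim\<close> bits.

  Both parameters make the same vertices suffice, for different reasons. With at most
  \<open>k\<close> tokens, no initial segment is longer than \<open>k\<close>. With at most
  \<open>k\<close> sets in the sequence, the token count of a class moves by less than
  \<open>k\<close> from its starting value, which is 0 or the size of the class because classes are
  refined by the start set. The constant 8 is 2 * 2 * 2: the start set and the target set each split
  a neighborhood class in two, and a refined class has two ends. With \<open>\<kappa>\<close> the
  sum of \<open>nd\<close> and the parameter, there are at most
  \<open>2 ^ (8 * \<kappa> * \<kappa>)\<close> states.\<close>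

definition code_at :: "instr list \<Rightarrow> nat \<Rightarrow> instr list \<Rightarrow> bool" where
  "code_at P b cs \<longleftrightarrow> (\<forall>i<length cs. b + i < length P \<and> P ! (b + i) = cs ! i)"

lemma code_at_Nil [simp]: "code_at P b []"
  by (simp add: code_at_def)

lemma code_at_Cons [simp]:
  "code_at P b (c # cs) \<longleftrightarrow> b < length P \<and> P ! b = c \<and> code_at P (Suc b) cs"
  unfolding code_at_def by (simp add: All_less_Suc2 conj_assoc)

lemma code_at_append [simp]:
  "code_at P b (cs @ ds) \<longleftrightarrow> code_at P b cs \<and> code_at P (b + length cs) ds"
  by (induction cs arbitrary: b) auto

definition runs :: "instr list \<Rightarrow> config \<Rightarrow> nat \<Rightarrow> config \<Rightarrow> bool" where
  "runs P c T c' \<longleftrightarrow> (\<exists>k\<le>T. (step P ^^ k) c = c')"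

lemma runs_refl: "runs P c T c"
  by (auto simp: runs_def intro: exI[of _ 0])

lemma runs_trans:
  assumes "runs P c T c'" "runs P c' T' c''"
  shows "runs P c (T + T') c''"
proof -
  obtain k k' where "k \<le> T" "(step P ^^ k) c = c'" "k' \<le> T'" "(step P ^^ k') c' = c''"
    using assms by (auto simp: runs_def)
  then have "(step P ^^ (k' + k)) c = c''" "k' + k \<le> T + T'"
    by (simp_all add: funpow_add)
  then show ?thesis unfolding runs_def by blast
qed

lemma runs_mono: "runs P c T c' \<Longrightarrow> T \<le> T' \<Longrightarrow> runs P c T' c'"
  unfolding runs_def using le_trans by blast

text \<open>Prepends one instruction; applied repeatedly, it executes straight-line code
  symbolically.\<close>

lemma runs_step:
  assumes "b < length P" "P ! b = I" "exec I (b, R) = d" "runs P d T c'"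
  shows "runs P (b, R) (Suc T) c'"
proof -
  obtain k where "k \<le> T" "(step P ^^ k) d = c'"
    using assms by (auto simp: runs_def)
  then have "(step P ^^ Suc k) (b, R) = c'"
    using assms by (simp add: step_def halted_def funpow_Suc_right del: funpow.simps)
  with \<open>k \<le> T\<close> show ?thesis unfolding runs_def by (intro exI[of _ "Suc k"]) simp
qed

lemma runs_step1:
  assumes "b < length P" "P ! b = I" "exec I (b, R) = c'"
  shows "runs P (b, R) 1 c'"
  using runs_step[OF assms runs_refl, of 0] by simp

section \<open>Functions evaluated by machine code in polynomial time\<close>

text \<open>Base 4 although letters are at most 2: the machine only doubles and halves. Cell 0, the
  length of the word, is unbounded and therefore becomes the leading digit.\<close>

fun pack :: "nat \<Rightarrow> (nat \<Rightarrow> nat) \<Rightarrow> nat" where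
  "pack 0 M = M 0"
| "pack (Suc k) M = 4 * pack k M + M (Suc k)"

definition small :: "(nat \<Rightarrow> nat) \<Rightarrow> bool" where
  "small M \<longleftrightarrow> (\<forall>i>0. M i < 4)"

text \<open>
  The cells \<open>0, \<dots>, K\<close> of the initial memory \<open>M\<close> are packed into register 0, which frees the
  registers \<open>1, \<dots>, K\<close> for local variables; the cells above \<open>K\<close> are never changed.
  The arguments of the evaluated function are found in the registers \<open>ps\<close>, and its value is left
  in register \<open>t\<close>.
\<close>

definition evaluates :: "nat \<Rightarrow> nat \<Rightarrow> nat list \<Rightarrow> ((nat \<Rightarrow> nat) \<Rightarrow> nat) \<Rightarrow>
    ((nat \<Rightarrow> nat) \<Rightarrow> nat list \<Rightarrow> nat) \<Rightarrow> (nat \<Rightarrow> instr list) \<Rightarrow> nat \<Rightarrow> nat \<Rightarrow> bool" where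
  "evaluates K t ps G f cg n c \<longleftrightarrow>
     (\<forall>b. length (cg b) = n) \<and>
     (\<forall>b P M R. small M \<longrightarrow> R 0 = pack K M \<longrightarrow> (\<forall>i>K. R i = M i) \<longrightarrow> code_at P b (cg b) \<longrightarrow>
        (\<exists>R'. runs P (b, R) ((G M + 2) ^ c) (b + n, R') \<and> R' t = f M (map R ps) \<and>
              (\<forall>i. i < t \<or> K < i \<longrightarrow> R' i = R i)))"

text \<open>\<open>s\<close> is the stack depth: code must exist for every target register
  \<open>t\<close> that lies above its arguments and leaves \<open>s\<close> freed registers above
  itself. The code depends on its start address because jumps are absolute.\<close>

definition polytimeK :: "nat \<Rightarrow> nat \<Rightarrow> ((nat \<Rightarrow> nat) \<Rightarrow> nat) \<Rightarrow>
    ((nat \<Rightarrow> nat) \<Rightarrow> nat list \<Rightarrow> nat) \<Rightarrow> bool" where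
  "polytimeK K s G f \<longleftrightarrow>
     (\<forall>t ps. 0 < t \<and> (\<forall>p\<in>set ps. 0 < p \<and> p < t) \<and> t + s \<le> K \<longrightarrow>
        (\<exists>cg n c. evaluates K t ps G f cg n c))"

lemma polytimeKI:
  assumes "\<And>t ps. 0 < t \<Longrightarrow> (\<And>p. p \<in> set ps \<Longrightarrow> 0 < p \<and> p < t) \<Longrightarrow> t + s \<le> K \<Longrightarrow>
     \<exists>cg n c. evaluates K t ps G f cg n c"
  shows "polytimeK K s G f"
  using assms unfolding polytimeK_def by blast

lemma polytimeKE:
  assumes "polytimeK K s G f" "0 < t" "\<And>p. p \<in> set ps \<Longrightarrow> 0 < p \<and> p < t" "t + s \<le> K"
  obtains cg n c where "evaluates K t ps G f cg n c"
  using assms unfolding polytimeK_def by blast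

lemma evaluatesE:
  assumes "evaluates K t ps G f cg n c" "small M" "R 0 = pack K M" "\<And>i. i > K \<Longrightarrow> R i = M i"
    "code_at P b (cg b)"
  obtains R' where "runs P (b, R) ((G M + 2) ^ c) (b + n, R')" "R' t = f M (map R ps)"
    "\<And>i. i < t \<or> K < i \<Longrightarrow> R' i = R i"
  using assms(1)[unfolded evaluates_def, THEN conjunct2, rule_format, OF assms(2-5)] that by blast

lemma evaluates_length: "evaluates K t ps G f cg n c \<Longrightarrow> length (cg b) = n"
  by (simp add: evaluates_def)

lemma evaluatesI:
  assumes "\<And>b. length (cg b) = n"
    "\<And>b P M R. small M \<Longrightarrow> R 0 = pack K M \<Longrightarrow> (\<And>i. i > K \<Longrightarrow> R i = M i) \<Longrightarrow> code_at P b (cg b) \<Longrightarrow>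
        (\<exists>T R'. runs P (b, R) T (b + n, R') \<and> T \<le> (G M + 2) ^ c \<and> R' t = f M (map R ps) \<and>
              (\<forall>i. i < t \<or> K < i \<longrightarrow> R' i = R i))"
  shows "evaluates K t ps G f cg n c"
proof -
  have "\<exists>R'. runs P (b, R) ((G M + 2) ^ c) (b + n, R') \<and> R' t = f M (map R ps) \<and>
              (\<forall>i. i < t \<or> K < i \<longrightarrow> R' i = R i)"
    if "small M" "R 0 = pack K M" "\<forall>i>K. R i = M i" "code_at P b (cg b)" for b P M R
    using assms(2)[of M R P b] that runs_mono by blast
  with assms(1) show ?thesis unfolding evaluates_def by blast
qed

lemma evaluates_witness:
  assumes "runs P c T (b', R')" "T \<le> X" "R' t = v" "\<And>i. i < t \<or> K < i \<Longrightarrow> R' i = R i"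
  shows "\<exists>T R'. runs P c T (b', R') \<and> T \<le> X \<and> R' t = v \<and> (\<forall>i. i < t \<or> K < i \<longrightarrow> R' i = R i)"
  using assms by blast

lemma le_pow: "(k::nat) \<le> (x + 2) ^ k"
proof -
  have "k \<le> 2 ^ k" by simp
  also have "\<dots> \<le> (x + 2) ^ k" by (rule power_mono) auto
  finally show ?thesis .
qed

text \<open>The base is at least 2, so the factor 2 is paid for by one more exponent. This is why
  times are measured in powers of \<open>G M + 2\<close>.\<close>

lemma pow_add_pow_le: "((x::nat) + 2) ^ a + (x + 2) ^ b \<le> (x + 2) ^ Suc (a + b)"
proof -
  have "(x + 2) ^ a \<le> (x + 2) ^ (a + b)" "(x + 2) ^ b \<le> (x + 2) ^ (a + b)"
    by (rule power_increasing; simp)+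
  then have "(x + 2) ^ a + (x + 2) ^ b \<le> 2 * (x + 2) ^ (a + b)" by linarith
  also have "\<dots> \<le> (x + 2) * (x + 2) ^ (a + b)" by (rule mult_le_mono1) simp
  finally show ?thesis by simp
qed

lemma pow_add_le:
  assumes "u \<le> ((x::nat) + 2) ^ a" "v \<le> (x + 2) ^ b"
  shows "u + v \<le> (x + 2) ^ Suc (a + b)"
  using add_le_mono[OF assms] pow_add_pow_le order_trans by blast

lemma pow_mult_le:
  assumes "u \<le> ((x::nat) + 2) ^ a" "v \<le> (x + 2) ^ b"
  shows "u * v \<le> (x + 2) ^ (a + b)"
  using mult_le_mono[OF assms] by (simp add: power_add)


lemma evaluates_const:
  assumes "0 < t" "t \<le> K" "\<And>M R. f M (map R ps) = k"
  shows "evaluates K t ps G f (\<lambda>b. [Const t k]) 1 1"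
proof (rule evaluatesI)
  fix b P M R
  assume "code_at P b [Const t k]"
  then have "runs P (b, R) 1 (b + 1, R(t := k))"
    by (intro runs_step1[of _ _ "Const t k"]) auto
  then show "\<exists>T R'. runs P (b, R) T (b + 1, R') \<and> T \<le> (G M + 2) ^ 1 \<and> R' t = f M (map R ps) \<and>
              (\<forall>i. i < t \<or> K < i \<longrightarrow> R' i = R i)"
    using assms by (intro exI[of _ 1] exI[of _ "R(t := k)"]) auto
qed simp

lemma polytimeK_const: "polytimeK K 0 G (\<lambda>M e. k)"
  by (rule polytimeKI, intro exI, rule evaluates_const) simp_all

lemma evaluates_move:
  assumes "0 < t" "t \<le> K" "p \<noteq> t" "\<And>M R. R 0 = pack K M \<Longrightarrow> f M (map R ps) = R p"
  shows "evaluates K t ps G f (\<lambda>b. [Const t 0, Add t t p]) 2 2"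
proof (rule evaluatesI)
  fix b P M and R :: "nat \<Rightarrow> nat"
  assume *: "R 0 = pack K M" "code_at P b [Const t 0, Add t t p]"
  have "runs P (b, R) (Suc (Suc 0)) (b + 2, R(t := R p))"
    using * assms
    apply simp
    apply (elim conjE)
    apply (rule runs_step, assumption, assumption, simp)+
    apply (simp add: runs_refl)
    done
  moreover have "Suc (Suc 0) \<le> (G M + 2)\<^sup>2" using le_pow[of 2] by (metis numeral_2_eq_2)
  ultimately show "\<exists>T R'. runs P (b, R) T (b + 2, R') \<and> T \<le> (G M + 2)\<^sup>2 \<and> R' t = f M (map R ps) \<and>
            (\<forall>i. i < t \<or> K < i \<longrightarrow> R' i = R i)"
    using * assms by (intro exI[of _ "Suc (Suc 0)"] exI[of _ "R(t := R p)"]) auto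
qed simp

lemma polytimeK_pack: "polytimeK K 0 G (\<lambda>M e. pack K M)"
  by (rule polytimeKI, intro exI, rule evaluates_move[where p = 0]) simp_all

lemma polytimeK_reg: "polytimeK K 0 G (\<lambda>M e. hd ((tl ^^ j) e))"
proof (rule polytimeKI)
  fix t ps assume t: "(0::nat) < t" "t + 0 \<le> K" and ps: "\<And>p. p \<in> set ps \<Longrightarrow> 0 < p \<and> p < t"
  have drop: "(tl ^^ j) xs = drop j xs" for xs :: "nat list"
    by (induction j) (auto simp: drop_Suc tl_drop)
  show "\<exists>cg n c. evaluates K t ps G (\<lambda>M e. hd ((tl ^^ j) e)) cg n c"
  proof (cases "j < length ps")
    case False
    \<comment> \<open>Beyond the end of the argument list, \<open>hd []\<close> is some fixed
      number, so loading a constant is correct.\<close>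
    have "evaluates K t ps G (\<lambda>M e. hd ((tl ^^ j) e)) (\<lambda>b. [Const t (hd [])]) 1 1"
      by (rule evaluates_const) (use t False in \<open>auto simp: drop\<close>)
    then show ?thesis by blast
  next
    case True
    then have "ps ! j < t" using ps by auto
    then have "evaluates K t ps G (\<lambda>M e. hd ((tl ^^ j) e)) (\<lambda>b. [Const t 0, Add t t (ps ! j)]) 2 2"
      by (intro evaluates_move) (use t True in \<open>auto simp: drop drop_map hd_map hd_drop_conv_nth\<close>)
    then show ?thesis by blast
  qed
qed

text \<open>Weakening: an expression placed under a binder ignores the innermost variable.\<close>

lemma polytimeK_tl:
  assumes "polytimeK K s G f"
  shows "polytimeK K s G (\<lambda>M e. f M (tl e))"
proof (rule polytimeKI)
  fix t ps assume "(0::nat) < t" "t + s \<le> K" and ps: "\<And>p. p \<in> set ps \<Longrightarrow> 0 < p \<and> p < t"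
  have "\<And>p. p \<in> set (tl ps) \<Longrightarrow> 0 < p \<and> p < t"
    using ps by (metis list.sel(2) list.set_sel(2))
  then obtain cg n c where "evaluates K t (tl ps) G f cg n c"
    using polytimeKE[OF assms \<open>0 < t\<close> _ \<open>t + s \<le> K\<close>] by blast
  then have "evaluates K t ps G (\<lambda>M e. f M (tl e)) cg n c"
    by (simp add: evaluates_def map_tl)
  then show "\<exists>cg n c. evaluates K t ps G (\<lambda>M e. f M (tl e)) cg n c" by blast
qed

text \<open>The first operand waits in register \<open>t\<close> while the second one is evaluated
  with target \<open>Suc t\<close>, hence the extra register.\<close>

lemma polytimeK_op2:
  assumes f: "polytimeK K s G f" and g: "polytimeK K s' G g"
    and I: "\<And>t b R. exec (I t) (b, R) = (Suc b, R(t := h (R t) (R (Suc t))))"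
  shows "polytimeK K (s + s' + 1) G (\<lambda>M e. h (f M e) (g M e))"
proof (rule polytimeKI)
  fix t ps assume t: "(0::nat) < t" "t + (s + s' + 1) \<le> K" and ps: "\<And>p. p \<in> set ps \<Longrightarrow> 0 < p \<and> p < t"
  obtain cf nf c where ef: "evaluates K t ps G f cf nf c"
    using polytimeKE[OF f, of t ps] t ps by auto
  obtain cg ng d where eg: "evaluates K (Suc t) ps G g cg ng d"
    using polytimeKE[OF g, of "Suc t" ps] t ps by (auto simp: less_Suc_eq)
  have "evaluates K t ps G (\<lambda>M e. h (f M e) (g M e))
     (\<lambda>b. cf b @ cg (b + nf) @ [I t]) (nf + ng + 1) (Suc (Suc (c + d) + 1))"
  proof (rule evaluatesI)
    fix b P M R
    assume *: "small M" "R 0 = pack K M" "\<And>i. i > K \<Longrightarrow> R i = M i"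
      "code_at P b (cf b @ cg (b + nf) @ [I t])"
    obtain R1 where 1: "runs P (b, R) ((G M + 2) ^ c) (b + nf, R1)" "R1 t = f M (map R ps)"
      "\<And>i. i < t \<or> K < i \<Longrightarrow> R1 i = R i"
      using evaluatesE[OF ef *(1), of R P b] * by auto
    obtain R2 where 2: "runs P (b + nf, R1) ((G M + 2) ^ d) (b + nf + ng, R2)"
      "R2 (Suc t) = g M (map R1 ps)" "\<And>i. i < Suc t \<or> K < i \<Longrightarrow> R2 i = R1 i"
      using evaluatesE[OF eg *(1), of R1 P "b + nf"] * 1 t evaluates_length[OF ef] by auto
    have [simp]: "map R1 ps = map R ps" using ps 1 by auto
    have 3: "runs P (b + nf + ng, R2) 1 (b + (nf + ng + 1), R2(t := h (R2 t) (R2 (Suc t))))"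
      using * evaluates_length[OF ef] evaluates_length[OF eg]
      by (intro runs_step1[of _ _ "I t"]) (auto simp: I add.assoc)
    have "runs P (b, R) ((G M + 2) ^ c + (G M + 2) ^ d + 1)
       (b + (nf + ng + 1), R2(t := h (R2 t) (R2 (Suc t))))"
      by (rule runs_trans[OF runs_trans[OF 1(1) 2(1)] 3])
    moreover have "(G M + 2) ^ c + (G M + 2) ^ d + 1 \<le> (G M + 2) ^ Suc (Suc (c + d) + 1)"
      by (intro pow_add_le order_refl le_pow)
    ultimately show "\<exists>T R'. runs P (b, R) T (b + (nf + ng + 1), R') \<and>
        T \<le> (G M + 2) ^ Suc (Suc (c + d) + 1) \<and>
        R' t = h (f M (map R ps)) (g M (map R ps)) \<and> (\<forall>i. i < t \<or> K < i \<longrightarrow> R' i = R i)"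
      by (rule evaluates_witness) (use 1 2 t in auto)
  qed (use ef eg in \<open>auto simp: evaluates_length\<close>)
  then show "\<exists>cg n c. evaluates K t ps G (\<lambda>M e. h (f M e) (g M e)) cg n c" by blast
qed

lemma polytimeK_add: "polytimeK K s G f \<Longrightarrow> polytimeK K s' G g \<Longrightarrow> polytimeK K (s + s' + 1) G (\<lambda>M e. f M e + g M e)"
  by (rule polytimeK_op2[where I = "\<lambda>t. Add t t (Suc t)"]) auto

lemma polytimeK_sub: "polytimeK K s G f \<Longrightarrow> polytimeK K s' G g \<Longrightarrow> polytimeK K (s + s' + 1) G (\<lambda>M e. f M e - g M e)"
  by (rule polytimeK_op2[where I = "\<lambda>t. Sub t t (Suc t)"]) auto

lemma polytimeK_half: "polytimeK K s G f \<Longrightarrow> polytimeK K (s + 1) G (\<lambda>M e. f M e div 2)"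
  using polytimeK_op2[where I = "\<lambda>t. Half t t" and h = "\<lambda>x y. x div 2" and g = "\<lambda>M e. 0", OF _ polytimeK_const]
  by fastforce

text \<open>Only the cells above \<open>K\<close> can be read directly.\<close>

lemma polytimeK_high:
  assumes f: "polytimeK K s G f"
  shows "polytimeK K (s + 1) G (\<lambda>M e. if f M e \<le> K then 0 else M (f M e))"
proof (rule polytimeKI)
  fix t ps assume t: "(0::nat) < t" "t + (s + 1) \<le> K" and ps: "\<And>p. p \<in> set ps \<Longrightarrow> 0 < p \<and> p < t"
  obtain cf nf c where ef: "evaluates K t ps G f cf nf c"
    using polytimeKE[OF f, of t ps] t ps by auto
  let ?cs = "\<lambda>b. [Const (Suc t) K, Sub (Suc t) t (Suc t), JumpZ (Suc t) (b + 5), Load t t,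
    Jump (b + 6), Const t 0]"
  let ?f = "\<lambda>M e. if f M e \<le> K then 0 else M (f M e)"
  have "evaluates K t ps G ?f (\<lambda>b. cf b @ ?cs (b + nf)) (nf + 6) (Suc (c + 6))"
  proof (rule evaluatesI)
    fix b P M R
    assume *: "small M" "R 0 = pack K M" "\<And>i. i > K \<Longrightarrow> R i = M i"
      "code_at P b (cf b @ ?cs (b + nf))"
    obtain R1 where 1: "runs P (b, R) ((G M + 2) ^ c) (b + nf, R1)" "R1 t = f M (map R ps)"
      "\<And>i. i < t \<or> K < i \<Longrightarrow> R1 i = R i"
      using evaluatesE[OF ef *(1), of R P b] * by auto
    define R2 where "R2 = R1(Suc t := f M (map R ps) - K, t := ?f M (map R ps))"
    have 2: "runs P (b + nf, R1) 6 (b + (nf + 6), R2)"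
    proof (cases "f M (map R ps) \<le> K")
      case True
      have "runs P (b + nf, R1) (Suc (Suc (Suc (Suc 0)))) (b + (nf + 6), R2)"
        using True *(4) evaluates_length[OF ef] 1(2)
        apply (simp add: eval_nat_numeral)
        apply (elim conjE)
        apply (rule runs_step, assumption, assumption, simp)+
        apply (simp add: runs_def R2_def)
        done
      then show ?thesis by (rule runs_mono) simp
    next
      case False
      then have "R1 (f M (map R ps)) = M (f M (map R ps))" using 1(3) * by auto
      then have "runs P (b + nf, R1) (Suc (Suc (Suc (Suc (Suc 0))))) (b + (nf + 6), R2)"
        using False *(4) evaluates_length[OF ef] 1(2) t
        apply (simp add: eval_nat_numeral)
        apply (elim conjE)
        apply (rule runs_step, assumption, assumption, simp)+
        apply (auto simp add: runs_def R2_def)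
        done
      then show ?thesis by (rule runs_mono) simp
    qed
    have "runs P (b, R) ((G M + 2) ^ c + 6) (b + (nf + 6), R2)"
      by (rule runs_trans[OF 1(1) 2])
    moreover have "(G M + 2) ^ c + 6 \<le> (G M + 2) ^ Suc (c + 6)"
      by (intro pow_add_le order_refl le_pow)
    ultimately show "\<exists>T R'. runs P (b, R) T (b + (nf + 6), R') \<and>
        T \<le> (G M + 2) ^ Suc (c + 6) \<and> R' t = ?f M (map R ps) \<and> (\<forall>i. i < t \<or> K < i \<longrightarrow> R' i = R i)"
      by (rule evaluates_witness) (use 1 t in \<open>auto simp: R2_def\<close>)
  qed (use ef in \<open>auto simp: evaluates_length\<close>)
  then show "\<exists>cg n c. evaluates K t ps G ?f cg n c" by blast
qed

lemma polytimeK_if: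
  assumes f: "polytimeK K s G f" and g: "polytimeK K s' G g" and h: "polytimeK K s'' G h"
  shows "polytimeK K (s + s' + s'') G (\<lambda>M e. if f M e = 0 then g M e else h M e)"
proof (rule polytimeKI)
  fix t ps assume t: "(0::nat) < t" "t + (s + s' + s'') \<le> K"
    and ps: "\<And>p. p \<in> set ps \<Longrightarrow> 0 < p \<and> p < t"
  obtain cf nf c where ef: "evaluates K t ps G f cf nf c"
    using polytimeKE[OF f, of t ps] t ps by auto
  obtain cg ng d where eg: "evaluates K t ps G g cg ng d"
    using polytimeKE[OF g, of t ps] t ps by auto
  obtain ch nh d' where eh: "evaluates K t ps G h ch nh d'"
    using polytimeKE[OF h, of t ps] t ps by auto
  note [simp] = evaluates_length[OF ef] evaluates_length[OF eg] evaluates_length[OF eh]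
  let ?f = "\<lambda>M e. if f M e = 0 then g M e else h M e"
  define cs where "cs = (\<lambda>b. cf b @ JumpZ t (b + (nf + 1 + nh + 1)) # ch (b + (nf + 1)) @
    Jump (b + (nf + 1 + nh + 1 + ng)) # cg (b + (nf + 1 + nh + 1)))"
  define n where "n = nf + 1 + nh + 1 + ng"
  have "evaluates K t ps G ?f cs n (Suc (Suc (c + 1) + Suc (Suc (d + d') + 1)))"
  proof (rule evaluatesI)
    fix b P M R
    assume *: "small M" "R 0 = pack K M" "\<And>i. i > K \<Longrightarrow> R i = M i" "code_at P b (cs b)"
    obtain R1 where 1: "runs P (b, R) ((G M + 2) ^ c) (b + nf, R1)" "R1 t = f M (map R ps)"
      "\<And>i. i < t \<or> K < i \<Longrightarrow> R1 i = R i"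
      using evaluatesE[OF ef *(1), of R P b] * by (auto simp: cs_def)
    have [simp]: "map R1 ps = map R ps" using ps 1 by auto
    have "\<exists>R2. runs P (b + nf, R1) (1 + ((G M + 2) ^ d + (G M + 2) ^ d' + 1)) (b + n, R2) \<and>
      R2 t = ?f M (map R ps) \<and> (\<forall>i. i < t \<or> K < i \<longrightarrow> R2 i = R1 i)"
    proof (cases "f M (map R ps) = 0")
      case True
      have 2: "runs P (b + nf, R1) 1 (b + (nf + 1 + nh + 1), R1)"
        using True 1 *(4) by (intro runs_step1) (auto simp: cs_def)
      obtain R2 where 3: "runs P (b + (nf + 1 + nh + 1), R1) ((G M + 2) ^ d)
         (b + (nf + 1 + nh + 1) + ng, R2)" "R2 t = g M (map R ps)"
        "\<And>i. i < t \<or> K < i \<Longrightarrow> R2 i = R1 i"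
        using evaluatesE[OF eg *(1), of R1 P "b + (nf + 1 + nh + 1)"] * 1 t
        by (auto simp: cs_def add.assoc)
      have "runs P (b + nf, R1) (1 + ((G M + 2) ^ d + (G M + 2) ^ d' + 1)) (b + n, R2)"
        using runs_mono[OF runs_trans[OF 2 3(1)]] by (simp add: n_def add.assoc)
      then show ?thesis using 3 True by auto
    next
      case False
      have 2: "runs P (b + nf, R1) 1 (b + (nf + 1), R1)"
        using False 1 *(4) by (intro runs_step1) (auto simp: cs_def)
      obtain R2 where 3: "runs P (b + (nf + 1), R1) ((G M + 2) ^ d')
         (b + (nf + 1) + nh, R2)" "R2 t = h M (map R ps)"
        "\<And>i. i < t \<or> K < i \<Longrightarrow> R2 i = R1 i"
        using evaluatesE[OF eh *(1), of R1 P "b + (nf + 1)"] * 1 t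
        by (auto simp: cs_def add.assoc)
      have 4: "runs P (b + (nf + 1) + nh, R2) 1 (b + n, R2)"
        using *(4) by (intro runs_step1) (auto simp: cs_def n_def add.assoc)
      have "runs P (b + nf, R1) (1 + ((G M + 2) ^ d + (G M + 2) ^ d' + 1)) (b + n, R2)"
        by (rule runs_mono[OF runs_trans[OF runs_trans[OF 2 3(1)] 4]]) auto
      then show ?thesis using 3 False by auto
    qed
    then obtain R2 where 2: "runs P (b + nf, R1) (1 + ((G M + 2) ^ d + (G M + 2) ^ d' + 1)) (b + n, R2)"
      "R2 t = ?f M (map R ps)" "\<And>i. i < t \<or> K < i \<Longrightarrow> R2 i = R1 i" by blast
    have "runs P (b, R) ((G M + 2) ^ c + 1 + ((G M + 2) ^ d + (G M + 2) ^ d' + 1)) (b + n, R2)"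
      using runs_trans[OF 1(1) 2(1)] by (simp add: add.assoc)
    moreover have "(G M + 2) ^ c + 1 + ((G M + 2) ^ d + (G M + 2) ^ d' + 1)
       \<le> (G M + 2) ^ (Suc (Suc (c + 1) + Suc (Suc (d + d') + 1)))"
      by (intro pow_add_le order_refl le_pow)
    ultimately show "\<exists>T R'. runs P (b, R) T (b + n, R') \<and>
        T \<le> (G M + 2) ^ (Suc (Suc (c + 1) + Suc (Suc (d + d') + 1))) \<and>
        R' t = ?f M (map R ps) \<and> (\<forall>i. i < t \<or> K < i \<longrightarrow> R' i = R i)"
      by (rule evaluates_witness) (use 1 2 t in auto)
  qed (simp add: cs_def n_def)
  then show "\<exists>cg n c. evaluates K t ps G ?f cg n c" by blast
qed

text \<open>End of a round of the loop in \<open>polytimeK_rec\<close>: the new value moves from the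
  work register \<open>t + 3\<close> to the accumulator \<open>t\<close>, the index
  \<open>t + 1\<close> goes up, the number \<open>t + 2\<close> of remaining rounds goes
  down.\<close>

lemma runs_loop_tail:
  assumes "code_at P b [Const t 0, Add t t (t + 3), Const (t + 3) 1, Add (t + 1) (t + 1) (t + 3),
     Sub (t + 2) (t + 2) (t + 3), Jump h]"
  shows "runs P (b, R) 6
    (h, R(t := R (t + 3), t + 3 := 1, t + 1 := Suc (R (t + 1)), t + 2 := R (t + 2) - 1))"
proof -
  have "runs P (b, R) (Suc (Suc (Suc (Suc (Suc (Suc 0))))))
    (h, R(t := R (t + 3), t + 3 := 1, t + 1 := Suc (R (t + 1)), t + 2 := R (t + 2) - 1))"
    using assms
    apply (simp add: eval_nat_numeral)
    apply (elim conjE)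
    apply (rule runs_step, assumption, assumption, simp)+
    apply (simp add: runs_def fun_eq_iff)
    done
  then show ?thesis by (simp add: eval_nat_numeral)
qed

text \<open>Primitive recursion as a counted loop. The body sees the accumulator as variable 0 and
  the index as variable 1. Only the number of rounds is bounded; the accumulated value may be
  arbitrarily large.\<close>

lemma polytimeK_rec:
  assumes z: "polytimeK K s G z" and k: "polytimeK K s' G k"
    and f: "polytimeK K s'' G (\<lambda>M e. f M (hd (tl e)) (hd e) (tl (tl e)))"
    and bound: "\<And>M e. small M \<Longrightarrow> k M e \<le> (G M + 2) ^ q"
  shows "polytimeK K (s + s' + s'' + 3) G (\<lambda>M e. rec_nat (z M e) (\<lambda>i a. f M i a e) (k M e))"
proof (rule polytimeKI)
  fix t ps assume t: "(0::nat) < t" "t + (s + s' + s'' + 3) \<le> K"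
    and ps: "\<And>p. p \<in> set ps \<Longrightarrow> 0 < p \<and> p < t"
  obtain cz nz dz where ez: "evaluates K t ps G z cz nz dz"
    using polytimeKE[OF z, of t ps] t ps by auto
  obtain ck nk dk where ek: "evaluates K (t + 2) ps G k ck nk dk"
    by (rule polytimeKE[OF k, of "t + 2" ps]) (use t ps in force)+
  obtain cf nf df where ef: "evaluates K (t + 3) (t # Suc t # ps) G
      (\<lambda>M e. f M (hd (tl e)) (hd e) (tl (tl e))) cf nf df"
    by (rule polytimeKE[OF f, of "t + 3" "t # Suc t # ps"]) (use t ps in force)+
  note [simp] = evaluates_length[OF ez] evaluates_length[OF ek] evaluates_length[OF ef]
  let ?f = "\<lambda>M e. rec_nat (z M e) (\<lambda>i a. f M i a e) (k M e)"
  define n where "n = nz + nk + 1 + (1 + nf + 6)"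
  define body where "body = (\<lambda>b. JumpZ (t + 2) (b + (1 + nf + 6)) # cf (b + 1) @
    [Const t 0, Add t t (t + 3), Const (t + 3) 1, Add (t + 1) (t + 1) (t + 3),
     Sub (t + 2) (t + 2) (t + 3), Jump b])"
  define cs where "cs = (\<lambda>b. cz b @ ck (b + nz) @ Const (t + 1) 0 # body (b + nz + nk + 1))"
  have "evaluates K t ps G ?f cs n (Suc (Suc (Suc (dz + dk) + 1) + Suc (q + Suc (df + 7) + 1)))"
  proof (rule evaluatesI)
    fix b P M R
    assume *: "small M" "R 0 = pack K M" "\<And>i. i > K \<Longrightarrow> R i = M i" "code_at P b (cs b)"
    let ?X = "G M + 2"
    let ?F = "\<lambda>i a. f M i a (map R ps)"
    obtain R1 where 1: "runs P (b, R) (?X ^ dz) (b + nz, R1)" "R1 t = z M (map R ps)"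
      "\<And>i. i < t \<or> K < i \<Longrightarrow> R1 i = R i"
      using evaluatesE[OF ez *(1), of R P b] * by (auto simp: cs_def)
    have [simp]: "map R1 ps = map R ps" using ps 1 by auto
    obtain R2 where 2: "runs P (b + nz, R1) (?X ^ dk) (b + nz + nk, R2)"
      "R2 (t + 2) = k M (map R ps)" "\<And>i. i < t + 2 \<or> K < i \<Longrightarrow> R2 i = R1 i"
      using evaluatesE[OF ek *(1), of R1 P "b + nz"] * 1 t by (auto simp: cs_def)
    define h where "h = b + nz + nk + 1"
    have at: "code_at P h (body h)" using * by (auto simp: cs_def h_def add.assoc)
    have 3: "runs P (b + nz + nk, R2) 1 (h, R2(t + 1 := 0))"
      using * by (intro runs_step1) (auto simp: cs_def h_def)
    \<comment> \<open>Invariant: \<open>i\<close> rounds are done, \<open>m\<close> remain, and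
      register \<open>t\<close> holds the value of the recursion after \<open>i\<close>
      rounds.\<close>
    have loop: "\<exists>R''. runs P (h, R') (m * (?X ^ df + 7) + 1) (h + (1 + nf + 6), R'') \<and>
        R'' t = rec_nat a ?F (i + m) \<and> (\<forall>i. i < t \<or> K < i \<longrightarrow> R'' i = R i)"
      if "R' t = rec_nat a ?F i" "R' (t + 1) = i" "R' (t + 2) = m"
        "\<And>i. i < t \<or> K < i \<Longrightarrow> R' i = R i" for R' a i m
      using that
    proof (induction m arbitrary: R' i)
      case 0
      have "runs P (h, R') 1 (h + (1 + nf + 6), R')"
        using at 0 by (intro runs_step1) (auto simp: body_def)
      then show ?case using 0 by auto
    next
      case (Suc m)
      have [simp]: "map R' ps = map R ps" using ps Suc.prems by auto
      have 1: "runs P (h, R') 1 (h + 1, R')"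
        using at Suc.prems by (intro runs_step1) (auto simp: body_def)
      obtain R1 where 2: "runs P (h + 1, R') (?X ^ df) (h + 1 + nf, R1)"
         "R1 (t + 3) = rec_nat a ?F (Suc i)" "\<And>i. i < t + 3 \<or> K < i \<Longrightarrow> R1 i = R' i"
        using evaluatesE[OF ef *(1), of R' P "h + 1"] * Suc.prems t at
        by (auto simp: body_def)
      define R2 where
        "R2 = R1(t := R1 (t + 3), t + 3 := 1, t + 1 := Suc (R1 (t + 1)), t + 2 := R1 (t + 2) - 1)"
      have 3: "runs P (h + 1 + nf, R1) 6 (h, R2)"
        unfolding R2_def by (rule runs_loop_tail) (use at in \<open>simp add: body_def add.assoc\<close>)
      have "R2 t = rec_nat a ?F (Suc i)" "R2 (t + 1) = Suc i" "R2 (t + 2) = m"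
        "\<And>i. i < t \<or> K < i \<Longrightarrow> R2 i = R i"
        using 2 Suc.prems t by (auto simp: R2_def)
      from Suc.IH[OF this] obtain R'' where
        4: "runs P (h, R2) (m * (?X ^ df + 7) + 1) (h + (1 + nf + 6), R'')"
        and 5: "R'' t = rec_nat a ?F (Suc i + m)" "\<forall>i. i < t \<or> K < i \<longrightarrow> R'' i = R i"
        by blast
      have "runs P (h, R') (Suc m * (?X ^ df + 7) + 1) (h + (1 + nf + 6), R'')"
        by (rule runs_mono[OF runs_trans[OF runs_trans[OF runs_trans[OF 1 2(1)] 3] 4]]) simp
      with 5 show ?case by auto
    qed
    obtain R3 where 4: "runs P (h, R2(t + 1 := 0)) (k M (map R ps) * (?X ^ df + 7) + 1)
        (h + (1 + nf + 6), R3)" "R3 t = rec_nat (z M (map R ps)) ?F (0 + k M (map R ps))"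
        "\<And>i. i < t \<or> K < i \<Longrightarrow> R3 i = R i"
    proof -
      have "(R2(t + 1 := 0)) i = R i" if "i < t \<or> K < i" for i
        using that 1 2 t by auto
      then show thesis
        using loop[of "R2(t + 1 := 0)" "z M (map R ps)" 0 "k M (map R ps)"] 1 2 that by force
    qed
    have "runs P (b, R) (?X ^ dz + ?X ^ dk + 1 + (k M (map R ps) * (?X ^ df + 7) + 1)) (b + n, R3)"
      using runs_trans[OF runs_trans[OF runs_trans[OF 1(1) 2(1)] 3] 4(1)]
      by (simp add: n_def h_def ac_simps)
    moreover have "?X ^ dz + ?X ^ dk + 1 + (k M (map R ps) * (?X ^ df + 7) + 1)
       \<le> ?X ^ (Suc (Suc (Suc (dz + dk) + 1) + Suc (q + Suc (df + 7) + 1)))"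
      by (intro pow_add_le pow_mult_le order_refl le_pow bound *)
    ultimately show "\<exists>T R'. runs P (b, R) T (b + n, R') \<and>
       T \<le> ?X ^ (Suc (Suc (Suc (dz + dk) + 1) + Suc (q + Suc (df + 7) + 1))) \<and>
       R' t = ?f M (map R ps) \<and> (\<forall>i. i < t \<or> K < i \<longrightarrow> R' i = R i)"
      by (rule evaluates_witness) (use 4 in auto)
  qed (simp add: cs_def body_def n_def)
  then show "\<exists>cg n c. evaluates K t ps G ?f cg n c" by blast
qed

text \<open>The value of \<open>g\<close> stays in register \<open>t\<close> and serves as the new
  innermost variable; the result of the body is finally copied down from
  \<open>Suc t\<close>.\<close>

lemma polytimeK_let:
  assumes f: "polytimeK K s G (\<lambda>M e. f M (hd e) (tl e))" and g: "polytimeK K s' G g"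
  shows "polytimeK K (s + s' + 1) G (\<lambda>M e. f M (g M e) e)"
proof (rule polytimeKI)
  fix t ps assume t: "(0::nat) < t" "t + (s + s' + 1) \<le> K" and ps: "\<And>p. p \<in> set ps \<Longrightarrow> 0 < p \<and> p < t"
  obtain cg ng c where eg: "evaluates K t ps G g cg ng c"
    using polytimeKE[OF g, of t ps] t ps by auto
  obtain cf nf d where ef: "evaluates K (Suc t) (t # ps) G (\<lambda>M e. f M (hd e) (tl e)) cf nf d"
    by (rule polytimeKE[OF f, of "Suc t" "t # ps"]) (use t ps in force)+
  note [simp] = evaluates_length[OF eg] evaluates_length[OF ef]
  define cs where "cs = (\<lambda>b. cg b @ cf (b + ng) @ [Const t 0, Add t t (Suc t)])"
  have "evaluates K t ps G (\<lambda>M e. f M (g M e) e) cs (ng + nf + 2) (Suc (Suc (c + d) + 2))"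
  proof (rule evaluatesI)
    fix b P M R
    assume *: "small M" "R 0 = pack K M" "\<And>i. i > K \<Longrightarrow> R i = M i" "code_at P b (cs b)"
    obtain R1 where 1: "runs P (b, R) ((G M + 2) ^ c) (b + ng, R1)" "R1 t = g M (map R ps)"
      "\<And>i. i < t \<or> K < i \<Longrightarrow> R1 i = R i"
      using evaluatesE[OF eg *(1), of R P b] * by (auto simp: cs_def)
    have [simp]: "map R1 ps = map R ps" using ps 1 by auto
    obtain R2 where 2: "runs P (b + ng, R1) ((G M + 2) ^ d) (b + ng + nf, R2)"
      "R2 (Suc t) = f M (g M (map R ps)) (map R ps)" "\<And>i. i < Suc t \<or> K < i \<Longrightarrow> R2 i = R1 i"
      using evaluatesE[OF ef *(1), of R1 P "b + ng"] * 1 t by (auto simp: cs_def)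
    have "runs P (b + ng + nf, R2) (Suc (Suc 0)) (b + (ng + nf + 2), R2(t := R2 (Suc t)))"
      using *(4)
      apply (simp add: cs_def add.assoc)
      apply (elim conjE)
      apply (rule runs_step, assumption, assumption, simp)+
      apply (simp add: runs_refl)
      done
    then have 3: "runs P (b + ng + nf, R2) 2 (b + (ng + nf + 2), R2(t := R2 (Suc t)))"
      by (rule runs_mono) simp
    have "runs P (b, R) ((G M + 2) ^ c + (G M + 2) ^ d + 2)
       (b + (ng + nf + 2), R2(t := R2 (Suc t)))"
      by (rule runs_trans[OF runs_trans[OF 1(1) 2(1)] 3])
    moreover have "(G M + 2) ^ c + (G M + 2) ^ d + 2 \<le> (G M + 2) ^ Suc (Suc (c + d) + 2)"
      by (intro pow_add_le order_refl le_pow)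
    ultimately show "\<exists>T R'. runs P (b, R) T (b + (ng + nf + 2), R') \<and>
        T \<le> (G M + 2) ^ Suc (Suc (c + d) + 2) \<and>
        R' t = f M (g M (map R ps)) (map R ps) \<and> (\<forall>i. i < t \<or> K < i \<longrightarrow> R' i = R i)"
      by (rule evaluates_witness) (use 1 2 t in auto)
  qed (simp add: cs_def)
  then show "\<exists>cg n c. evaluates K t ps G (\<lambda>M e. f M (g M e) e) cg n c" by blast
qed

lemma polytimeK_cong:
  assumes "\<And>M e. small M \<Longrightarrow> f M e = g M e"
  shows "polytimeK K s G f \<longleftrightarrow> polytimeK K s G g"
  unfolding polytimeK_def evaluates_def using assms by (simp cong: conj_cong imp_cong)

text \<open>Each division by 4 strips the digit of the last remaining cell, which is below 4 because
  its index is positive.\<close>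

lemma pack_high: "i + j = K \<Longrightarrow> small M \<Longrightarrow> pack K M div 4 ^ j = pack i M"
proof (induction j arbitrary: i)
  case (Suc j)
  have "pack K M div 4 ^ Suc j = pack K M div 4 ^ j div 4"
    by (simp only: power_Suc2 div_mult2_eq)
  also have "\<dots> = pack (Suc i) M div 4"
    using Suc.IH[of "Suc i"] Suc.prems by simp
  also have "\<dots> = pack i M"
    using Suc.prems by (simp add: small_def)
  finally show ?case .
qed simp

lemma pack_mod: "small M \<Longrightarrow> 0 < i \<Longrightarrow> i \<le> K \<Longrightarrow> pack K M div 4 ^ (K - i) mod 4 = M i"
  using pack_high[of i "K - i" K M] by (cases i) (auto simp: small_def)

lemma rec_nat_quarter: "rec_nat x (\<lambda>i a. a div 2 div 2) k = (x::nat) div 4 ^ k"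
  by (induction k) (simp_all add: div_mult2_eq[symmetric] mult.commute)

text \<open>
  The number \<open>s\<close> of registers must not depend on \<open>K\<close>, since \<open>K\<close> is chosen last.  In the functions
  \<open>f M e\<close> below, \<open>M\<close> is the input and \<open>e\<close> lists the values of the bound variables, innermost
  first.
\<close>

definition polytime :: "((nat \<Rightarrow> nat) \<Rightarrow> nat) \<Rightarrow> ((nat \<Rightarrow> nat) \<Rightarrow> nat list \<Rightarrow> nat) \<Rightarrow> bool" where
  "polytime G f \<longleftrightarrow> (\<exists>s. \<forall>K. polytimeK K s G f)"

lemma polytime_const: "polytime G (\<lambda>M e. k)"
  unfolding polytime_def using polytimeK_const by blast

lemma polytime_reg: "polytime G (\<lambda>M e. hd ((tl ^^ j) e))"
  unfolding polytime_def using polytimeK_reg by blast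

lemmas polytime_vars = polytime_reg[of _ 0, simplified] polytime_reg[of _ "Suc 0", simplified]
  polytime_reg[of _ "Suc (Suc 0)", simplified] polytime_reg[of _ "Suc (Suc (Suc 0))", simplified]
  polytime_reg[of _ "Suc (Suc (Suc (Suc 0)))", simplified]
  polytime_reg[of _ "Suc (Suc (Suc (Suc (Suc 0))))", simplified]

lemma polytime_lift1:
  assumes "\<And>K s. polytimeK K s G f \<Longrightarrow> polytimeK K (S s) G h" "polytime G f"
  shows "polytime G h"
  using assms unfolding polytime_def by blast

lemma polytime_lift2:
  assumes "\<And>K s s'. polytimeK K s G f \<Longrightarrow> polytimeK K s' G g \<Longrightarrow> polytimeK K (S s s') G h" "polytime G f" "polytime G g"
  shows "polytime G h"
  using assms unfolding polytime_def by blast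

lemma polytime_lift3:
  assumes "\<And>K s s' s''. polytimeK K s G f \<Longrightarrow> polytimeK K s' G g \<Longrightarrow> polytimeK K s'' G h \<Longrightarrow> polytimeK K (S s s' s'') G k"
    and "polytime G f" "polytime G g" "polytime G h"
  shows "polytime G k"
  using assms unfolding polytime_def by blast

lemma polytime_tl: "polytime G f \<Longrightarrow> polytime G (\<lambda>M e. f M (tl e))"
  by (rule polytime_lift1[OF polytimeK_tl])

lemma polytime_add: "polytime G f \<Longrightarrow> polytime G g \<Longrightarrow> polytime G (\<lambda>M e. f M e + g M e)"
  by (rule polytime_lift2[OF polytimeK_add])

lemma polytime_sub: "polytime G f \<Longrightarrow> polytime G g \<Longrightarrow> polytime G (\<lambda>M e. f M e - g M e)"
  by (rule polytime_lift2[OF polytimeK_sub])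

lemma polytime_half: "polytime G f \<Longrightarrow> polytime G (\<lambda>M e. f M e div 2)"
  by (rule polytime_lift1[OF polytimeK_half])

lemma polytime_if_zero:
  "polytime G f \<Longrightarrow> polytime G g \<Longrightarrow> polytime G h \<Longrightarrow> polytime G (\<lambda>M e. if f M e = 0 then g M e else h M e)"
  by (rule polytime_lift3[OF polytimeK_if])

lemma polytime_let:
  "polytime G (\<lambda>M e. f M (hd e) (tl e)) \<Longrightarrow> polytime G g \<Longrightarrow> polytime G (\<lambda>M e. f M (g M e) e)"
  by (rule polytime_lift2[OF polytimeK_let])

lemma polytime_rec:
  assumes "polytime G z" "polytime G k" "polytime G (\<lambda>M e. f M (hd (tl e)) (hd e) (tl (tl e)))"
    and "\<And>M e. small M \<Longrightarrow> k M e \<le> (G M + 2) ^ q"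
  shows "polytime G (\<lambda>M e. rec_nat (z M e) (\<lambda>i a. f M i a e) (k M e))"
  by (rule polytime_lift3[OF polytimeK_rec[where q = q, OF _ _ _ assms(4)] assms(1-3)])

text \<open>Cells above \<open>K\<close> are still in place and are loaded indirectly; a cell
  \<open>i\<close> up to \<open>K\<close> is the digit of register 0 exposed by \<open>K - i\<close>
  divisions by 4. For \<open>i = 0\<close> no remainder is taken, since the leading digit is the
  whole quotient. The code depends on \<open>K\<close>, the stack depth does not.\<close>

lemma polytime_read:
  assumes "polytime G f"
  shows "polytime G (\<lambda>M e. M (f M e))"
proof -
  obtain s where s: "\<And>K. polytimeK K s G f" using assms by (auto simp: polytime_def)
  define q where "q = (\<lambda>K M e. rec_nat (pack K M) (\<lambda>i a. a div 2 div 2) (K - f M e))"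
  have "\<exists>s. \<forall>K. polytimeK K s G (q K)"
  proof (intro exI allI)
    fix K
    \<comment> \<open>\<open>K\<close> is fixed once the program is, so these rounds count as a
      constant.\<close>
    have "K - k \<le> (G M + 2) ^ K" for k M
      using le_pow[of K "G M"] by linarith
    then show "polytimeK K (0 + (0 + s + 1) + (0 + 1 + 1) + 3) G (q K)"
      unfolding q_def
      by (rule polytimeK_rec[OF polytimeK_pack polytimeK_sub[OF polytimeK_const s]
          polytimeK_half[OF polytimeK_half[OF polytimeK_reg[where j = 0, simplified]]]])
  qed
  then obtain s' where s': "\<And>K. polytimeK K s' G (q K)" by auto
  have "\<exists>s. \<forall>K. polytimeK K s G (\<lambda>M e. if f M e - K = 0 then
      if f M e = 0 then q K M e
      else q K M e - (q K M e div 2 div 2 + q K M e div 2 div 2 +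
        (q K M e div 2 div 2 + q K M e div 2 div 2))
    else if f M e \<le> K then 0 else M (f M e))"
  proof (rule exI, rule allI)
    fix K
    show "polytimeK K (s + 0 + 1 + (s + s' + (s' + (s' + 1 + 1 + (s' + 1 + 1) + 1 + (s' + 1 + 1 + (s' + 1 + 1) + 1) + 1) + 1)) + (s + 1)) G (\<lambda>M e. if f M e - K = 0 then
        if f M e = 0 then q K M e
        else q K M e - (q K M e div 2 div 2 + q K M e div 2 div 2 +
          (q K M e div 2 div 2 + q K M e div 2 div 2))
      else if f M e \<le> K then 0 else M (f M e))"
      by (rule polytimeK_if polytimeK_sub polytimeK_add polytimeK_half polytimeK_high polytimeK_const s s')+
  qed
  then obtain s'' where s'': "\<And>K. polytimeK K s'' G (\<lambda>M e. if f M e - K = 0 then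
      if f M e = 0 then q K M e
      else q K M e - (q K M e div 2 div 2 + q K M e div 2 div 2 +
        (q K M e div 2 div 2 + q K M e div 2 div 2))
    else if f M e \<le> K then 0 else M (f M e))" by auto
  have "(if f M e - K = 0 then
      if f M e = 0 then q K M e
      else q K M e - (q K M e div 2 div 2 + q K M e div 2 div 2 +
        (q K M e div 2 div 2 + q K M e div 2 div 2))
    else if f M e \<le> K then 0 else M (f M e)) = M (f M e)" if "small M" for K M e
  proof -
    have q: "q K M e = pack K M div 4 ^ (K - f M e)" by (simp add: q_def rec_nat_quarter)
    \<comment> \<open>The remainder modulo 4, using only addition, subtraction and halving.\<close>
    have quarter: "x - (x div 2 div 2 + x div 2 div 2 + (x div 2 div 2 + x div 2 div 2)) = x mod 4"
      for x :: nat
    proof -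
      have "x div 2 div 2 = x div 4" by (simp flip: div_mult2_eq)
      moreover have "4 * (x div 4) + x mod 4 = x" by simp
      ultimately show ?thesis by linarith
    qed
    show ?thesis
      unfolding q quarter using pack_high[of 0 K K M] pack_mod[of M "f M e" K] that by simp
  qed
  then have "polytimeK K s'' G (\<lambda>M e. M (f M e))" for K
    by (rule iffD1[OF polytimeK_cong s''[of K]])
  then show ?thesis unfolding polytime_def by blast
qed

section \<open>From evaluation to programs\<close>

text \<open>The prologue shifts the cells \<open>1, \<dots>, K\<close> into register 0.\<close>

fun prologue :: "nat \<Rightarrow> instr list" where
  "prologue 0 = []"
| "prologue (Suc k) = prologue k @ [Add 0 0 0, Add 0 0 0, Add 0 0 (Suc k)]"

lemma length_prologue [simp]: "length (prologue k) = 3 * k"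
  by (induction k) auto

lemma runs_prologue: "code_at P 0 (prologue k) \<Longrightarrow> runs P (0, M) (3 * k) (3 * k, M(0 := pack k M))"
proof (induction k)
  case 0
  then show ?case by (simp add: runs_refl)
next
  case (Suc k)
  have "runs P (3 * k, M(0 := pack k M)) (Suc (Suc (Suc 0))) (3 * Suc k, M(0 := pack (Suc k) M))"
    using Suc.prems
    apply simp
    apply (elim conjE)
    apply (rule runs_step, assumption, assumption, simp)+
    apply (simp add: runs_def fun_eq_iff)
    done
  from runs_trans[OF Suc.IH this] Suc.prems
  have "runs P (0, M) (3 * k + Suc (Suc (Suc 0))) (3 * Suc k, M(0 := pack (Suc k) M))" by simp
  then show ?case by (rule runs_mono) simp
qed

lemma step_halted: "halted P c \<Longrightarrow> (step P ^^ k) c = c"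
  by (induction k) (simp_all add: step_def)

lemma halts_withinI:
  assumes "runs P c T (pc, R)" "length P \<le> pc" "R 0 = out" "T \<le> t"
  shows "halts_within P c t out"
proof -
  obtain k where k: "k \<le> T" "(step P ^^ k) c = (pc, R)" using assms by (auto simp: runs_def)
  have "halted P (pc, R)" using assms by (simp add: halted_def)
  have "(step P ^^ ((t - k) + k)) c = (step P ^^ (t - k)) ((step P ^^ k) c)"
    by (simp only: funpow_add comp_apply)
  also have "\<dots> = (pc, R)" using k step_halted[OF \<open>halted P (pc, R)\<close>] by simp
  finally have "(step P ^^ t) c = (pc, R)" using k assms by simp
  then show ?thesis using \<open>halted P (pc, R)\<close> assms by (simp add: halts_within_def)
qed

theorem polytime_program:
  assumes "polytime G f"
  obtains P c where "\<And>M t. small M \<Longrightarrow> (G M + 2) ^ c \<le> t \<Longrightarrow> halts_within P (0, M) t (f M [])"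
proof -
  obtain s where s: "\<And>K. polytimeK K s G f" using assms by (auto simp: polytime_def)
  \<comment> \<open>The result goes to register 1 and needs \<open>s\<close> registers above
    it.\<close>
  define K where "K = Suc s"
  obtain cg n c where ev: "evaluates K 1 [] G f cg n c"
    by (rule polytimeKE[OF s[of K], of 1 "[]"]) (simp_all add: K_def)
  define P where "P = prologue K @ cg (3 * K) @ [Const 0 0, Add 0 0 1]"
  have "halts_within P (0, M) t (f M [])" if "small M" "(G M + 2) ^ (Suc (Suc (3 * K + c) + 2)) \<le> t" for M t
  proof -
    have at: "code_at P 0 (prologue K @ cg (3 * K) @ [Const 0 0, Add 0 0 1])"
      unfolding P_def[symmetric] by (simp add: code_at_def)
    have 1: "runs P (0, M) (3 * K) (3 * K, M(0 := pack K M))"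
      by (rule runs_prologue) (use at in simp)
    have cd: "code_at P (3 * K) (cg (3 * K))" using at by simp
    obtain R where 2: "runs P (3 * K, M(0 := pack K M)) ((G M + 2) ^ c) (3 * K + n, R)"
      and R: "R 1 = f M []"
      by (rule evaluatesE[OF ev \<open>small M\<close>, of "M(0 := pack K M)" P "3 * K"]) (use cd in simp_all)
    have "runs P (3 * K + n, R) (Suc (Suc 0)) (3 * K + n + 2, R(0 := R 1))"
      using at evaluates_length[OF ev]
      apply simp
      apply (elim conjE)
      apply (rule runs_step, assumption, assumption, simp)+
      apply (simp add: runs_refl)
      done
    then have 3: "runs P (3 * K + n, R) 2 (3 * K + n + 2, R(0 := R 1))" by (rule runs_mono) simp
    have "3 * K + (G M + 2) ^ c + 2 \<le> (G M + 2) ^ Suc (Suc (3 * K + c) + 2)"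
      by (intro pow_add_le order_refl le_pow)
    then have le: "3 * K + (G M + 2) ^ c + 2 \<le> t" using that(2) by (rule order_trans)
    show ?thesis
      by (rule halts_withinI[OF runs_trans[OF runs_trans[OF 1 2] 3] _ _ le])
        (use R in \<open>simp_all add: evaluates_length[OF ev] P_def\<close>)
  qed
  then show thesis by (rule that[where P = P and c = "Suc (Suc (3 * K + c) + 2)"])
qed

section \<open>Bounded quantifiers, sums and counting\<close>

text \<open>A polynomial bound in the measure, demanded only of loop lengths and of exponents of 2,
  the latter being computed by loops.\<close>

definition bnd :: "((nat \<Rightarrow> nat) \<Rightarrow> nat) \<Rightarrow> ((nat \<Rightarrow> nat) \<Rightarrow> nat list \<Rightarrow> nat) \<Rightarrow> bool" where
  "bnd G k \<longleftrightarrow> (\<exists>q. \<forall>M e. small M \<longrightarrow> k M e \<le> (G M + 2) ^ q)"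

lemma bndI: "(\<And>M e. small M \<Longrightarrow> k M e \<le> G M) \<Longrightarrow> bnd G k"
  unfolding bnd_def by (intro exI[of _ 1]) (simp add: le_SucI)

lemma bnd_const: "bnd G (\<lambda>M e. k)"
  unfolding bnd_def using le_pow by blast

lemma bnd_min2: "bnd G k \<Longrightarrow> bnd G (\<lambda>M e. min (f M e) (k M e))"
  unfolding bnd_def using min.coboundedI2 by blast

lemma bnd_mult: "bnd G k \<Longrightarrow> bnd G l \<Longrightarrow> bnd G (\<lambda>M e. k M e * l M e)"
  unfolding bnd_def using pow_mult_le by meson

definition polytimeB :: "((nat \<Rightarrow> nat) \<Rightarrow> nat) \<Rightarrow> ((nat \<Rightarrow> nat) \<Rightarrow> nat list \<Rightarrow> bool) \<Rightarrow> bool" where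
  "polytimeB G P \<longleftrightarrow> polytime G (\<lambda>M e. of_bool (P M e))"

lemma polytime_rec_nat:
  assumes "polytime G z" "polytime G k" "polytime G (\<lambda>M e. f M (hd (tl e)) (hd e) (tl (tl e)))" "bnd G k"
  shows "polytime G (\<lambda>M e. rec_nat (z M e) (\<lambda>i a. f M i a e) (k M e))"
  using assms(4) unfolding bnd_def by (metis polytime_rec[OF assms(1-3)])

lemma polytime_if:
  assumes "polytimeB G P" "polytime G f" "polytime G g"
  shows "polytime G (\<lambda>M e. if P M e then f M e else g M e)"
proof -
  have "polytime G (\<lambda>M e. if of_bool (P M e) = (0::nat) then g M e else f M e)"
    using assms unfolding polytimeB_def by (intro polytime_if_zero)
  then show ?thesis by (rule back_subst[of "polytime G"]) (auto simp: fun_eq_iff)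
qed

lemma polytimeB_const: "polytimeB G (\<lambda>M e. b)"
  unfolding polytimeB_def by (rule polytime_const)

lemma polytimeB_nonzero:
  assumes "polytime G f"
  shows "polytimeB G (\<lambda>M e. f M e \<noteq> 0)"
proof -
  have "polytime G (\<lambda>M e. if f M e = 0 then 0 else 1)"
    by (intro polytime_if_zero assms polytime_const)
  then show ?thesis unfolding polytimeB_def by (rule back_subst[of "polytime G"]) (auto simp: fun_eq_iff)
qed

lemma polytimeB_not:
  assumes "polytimeB G P"
  shows "polytimeB G (\<lambda>M e. \<not> P M e)"
proof -
  have "polytime G (\<lambda>M e. if P M e then 0 else 1)"
    by (intro polytime_if assms polytime_const)
  then show ?thesis unfolding polytimeB_def by (rule back_subst[of "polytime G"]) (auto simp: fun_eq_iff)
qed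

lemma polytimeB_conj:
  assumes "polytimeB G P" "polytimeB G Q"
  shows "polytimeB G (\<lambda>M e. P M e \<and> Q M e)"
proof -
  have "polytime G (\<lambda>M e. if P M e then of_bool (Q M e) else 0)"
    using assms(2) by (intro polytime_if assms(1) polytime_const) (simp add: polytimeB_def)
  then show ?thesis unfolding polytimeB_def by (rule back_subst[of "polytime G"]) (auto simp: fun_eq_iff)
qed

lemma polytimeB_disj: "polytimeB G P \<Longrightarrow> polytimeB G Q \<Longrightarrow> polytimeB G (\<lambda>M e. P M e \<or> Q M e)"
  using polytimeB_not[OF polytimeB_conj[OF polytimeB_not[of G P] polytimeB_not[of G Q]]] by simp

lemma polytimeB_imp: "polytimeB G P \<Longrightarrow> polytimeB G Q \<Longrightarrow> polytimeB G (\<lambda>M e. P M e \<longrightarrow> Q M e)"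
  unfolding imp_conv_disj by (intro polytimeB_disj polytimeB_not)

lemma polytimeB_iff: "polytimeB G P \<Longrightarrow> polytimeB G Q \<Longrightarrow> polytimeB G (\<lambda>M e. P M e \<longleftrightarrow> Q M e)"
  unfolding iff_conv_conj_imp by (intro polytimeB_conj polytimeB_imp)

lemma polytimeB_less: "polytime G f \<Longrightarrow> polytime G g \<Longrightarrow> polytimeB G (\<lambda>M e. f M e < g M e)"
  using polytimeB_nonzero[OF polytime_sub[of G g f]] by (simp add: not_le)

lemma polytimeB_le: "polytime G f \<Longrightarrow> polytime G g \<Longrightarrow> polytimeB G (\<lambda>M e. f M e \<le> g M e)"
  unfolding not_less[symmetric] by (intro polytimeB_not polytimeB_less)

lemma polytimeB_eq: "polytime G f \<Longrightarrow> polytime G g \<Longrightarrow> polytimeB G (\<lambda>M e. f M e = g M e)"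
  unfolding eq_iff by (intro polytimeB_conj polytimeB_le)

lemma polytime_Suc: "polytime G f \<Longrightarrow> polytime G (\<lambda>M e. Suc (f M e))"
  using polytime_add[of G f "\<lambda>M e. 1", OF _ polytime_const] by simp

lemma polytime_min: "polytime G f \<Longrightarrow> polytime G g \<Longrightarrow> polytime G (\<lambda>M e. min (f M e) (g M e))"
  unfolding min_def by (intro polytime_if polytimeB_le)

lemma polytimeB_odd:
  assumes "polytime G f"
  shows "polytimeB G (\<lambda>M e. odd (f M e))"
proof -
  have "polytimeB G (\<lambda>M e. f M e \<noteq> f M e div 2 + f M e div 2)"
    by (intro polytimeB_not polytimeB_eq polytime_add polytime_half assms)
  also have "(\<lambda>M e. f M e \<noteq> f M e div 2 + f M e div 2) = (\<lambda>M e. odd (f M e))"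
    by (intro ext) presburger
  finally show ?thesis .
qed

lemma polytime_sum:
  assumes "polytime G k" "bnd G k" "polytime G (\<lambda>M e. f M (hd e) (tl e))"
  shows "polytime G (\<lambda>M e. \<Sum>i<k M e. f M i e)"
proof -
  have "polytime G (\<lambda>M e. rec_nat 0 (\<lambda>i a. a + f M i e) (k M e))"
    by (rule polytime_rec_nat[OF polytime_const assms(1) _ assms(2)],
        rule polytime_add[OF polytime_vars(1) polytime_tl[OF assms(3)]])
  moreover have "rec_nat 0 (\<lambda>i a. a + f M i e) l = (\<Sum>i<l. f M i e)" for M e l
    by (induction l) auto
  ultimately show ?thesis by simp
qed

lemma polytime_card:
  assumes "polytime G k" "bnd G k" "polytimeB G (\<lambda>M e. P M (hd e) (tl e))"
  shows "polytime G (\<lambda>M e. card {i. i < k M e \<and> P M i e})"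
proof -
  have "polytime G (\<lambda>M e. \<Sum>i<k M e. of_bool (P M i e))"
    using assms by (intro polytime_sum) (simp_all add: polytimeB_def)
  moreover have "(\<Sum>i<k M e. of_bool (P M i e)) = card {i. i < k M e \<and> P M i e}" for M e
    by (simp add: of_bool_def sum.If_cases lessThan_def Collect_conj_eq)
  ultimately show ?thesis by simp
qed

lemma polytimeB_Ex:
  assumes "polytime G k" "bnd G k" "polytimeB G (\<lambda>M e. P M (hd e) (tl e))"
  shows "polytimeB G (\<lambda>M e. \<exists>i<k M e. P M i e)"
  using polytimeB_nonzero[OF polytime_card[OF assms]] by (simp add: card_gt_0_iff)

lemma polytimeB_All:
  assumes "polytime G k" "bnd G k" "polytimeB G (\<lambda>M e. P M (hd e) (tl e))"
  shows "polytimeB G (\<lambda>M e. \<forall>i<k M e. P M i e)"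
  using polytimeB_not[OF polytimeB_Ex[OF assms(1,2) polytimeB_not[OF assms(3)]]] by simp

text \<open>Multiplication is repeated addition of the first factor, so the bound concerns the
  second one.\<close>

lemma polytime_mult:
  assumes "polytime G f" "polytime G g" "bnd G g"
  shows "polytime G (\<lambda>M e. f M e * g M e)"
proof -
  have "polytime G (\<lambda>M e. \<Sum>i<g M e. f M e)"
    by (intro polytime_sum assms polytime_tl)
  then show ?thesis by (simp add: mult.commute)
qed

lemma polytime_pow2:
  assumes "polytime G f" "bnd G f"
  shows "polytime G (\<lambda>M e. 2 ^ f M e)"
proof -
  have "polytime G (\<lambda>M e. rec_nat 1 (\<lambda>i a. a + a) (f M e))"
    by (rule polytime_rec_nat[OF polytime_const assms(1) polytime_add assms(2)]) (rule polytime_vars)+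
  moreover have "rec_nat 1 (\<lambda>i a. a + a) l = (2::nat) ^ l" for l
    by (induction l) auto
  ultimately show ?thesis by simp
qed

lemma polytime_div_pow2:
  assumes "polytime G f" "polytime G g" "bnd G g"
  shows "polytime G (\<lambda>M e. f M e div 2 ^ g M e)"
proof -
  have "polytime G (\<lambda>M e. rec_nat (f M e) (\<lambda>i a. a div 2) (g M e))"
    by (rule polytime_rec_nat[OF assms(1,2) polytime_half assms(3)]) (rule polytime_vars)
  moreover have "rec_nat x (\<lambda>i a. a div 2) l = x div 2 ^ l" for x l :: nat
    by (induction l) (auto simp: div_mult2_eq[symmetric] mult.commute)
  ultimately show ?thesis by simp
qed

text \<open>Lets a function be analysed with a variable as its argument: the actual argument is
  evaluated once beforehand and need not be weakened under the quantifiers of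
  \<open>f\<close>.\<close>

lemma polytime_app1: "polytime G (\<lambda>M e. f M (hd e)) \<Longrightarrow> polytime G a \<Longrightarrow> polytime G (\<lambda>M e. f M (a M e))"
  by (rule polytime_let[where f = "\<lambda>M x e. f M x"])

lemma polytime_app2:
  assumes "polytime G (\<lambda>M e. f M (hd e) (hd (tl e)))" "polytime G a" "polytime G b"
  shows "polytime G (\<lambda>M e. f M (a M e) (b M e))"
proof -
  have "polytime G (\<lambda>M e. f M (a M (tl e)) (hd e))"
    by (rule polytime_let[where f = "\<lambda>M x e. f M x (hd e)", OF assms(1) polytime_tl[OF assms(2)]])
  from polytime_let[where f = "\<lambda>M y e. f M (a M e) y", OF this assms(3)] show ?thesis .
qed

lemma polytimeB_app1: "polytimeB G (\<lambda>M e. P M (hd e)) \<Longrightarrow> polytime G a \<Longrightarrow> polytimeB G (\<lambda>M e. P M (a M e))"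
  unfolding polytimeB_def by (rule polytime_app1)

lemma polytimeB_app2:
  "polytimeB G (\<lambda>M e. P M (hd e) (hd (tl e))) \<Longrightarrow> polytime G a \<Longrightarrow> polytime G b \<Longrightarrow>
    polytimeB G (\<lambda>M e. P M (a M e) (b M e))"
  unfolding polytimeB_def by (rule polytime_app2)

lemmas polytime_rules = polytime_vars polytime_const polytime_read polytime_add polytime_sub polytime_Suc polytime_min polytime_if
  polytime_card polytimeB_const polytimeB_not polytimeB_conj polytimeB_disj polytimeB_imp polytimeB_iff polytimeB_less polytimeB_le
  polytimeB_eq polytimeB_Ex polytimeB_All

section \<open>The decision procedure and its running time\<close>

section \<open>The algorithm\<close>

subsection \<open>Frozen and active vertices\<close>

locale reconf_data =
  fixes n :: nat and E :: "nat \<Rightarrow> nat \<Rightarrow> bool" and s t :: "nat \<Rightarrow> bool" and k :: nat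
begin

text \<open>The twin relation behind neighborhood diversity, refined by \<open>s\<close> and
  \<open>t\<close>, with a quantifier bounded by \<open>n\<close> so that the machine can evaluate
  it.\<close>

definition eqv :: "nat \<Rightarrow> nat \<Rightarrow> bool" where
  "eqv u v \<longleftrightarrow> (\<forall>x<n. (E u x \<and> x \<noteq> v) \<longleftrightarrow> (E v x \<and> x \<noteq> u)) \<and> (s u \<longleftrightarrow> s v) \<and> (t u \<longleftrightarrow> t v)"

definition idx :: "nat \<Rightarrow> nat" where
  "idx v = card {u. u < n \<and> u < v \<and> eqv u v}"

definition csize :: "nat \<Rightarrow> nat" where
  "csize v = card {u. u < n \<and> eqv u v}"

definition active :: "nat \<Rightarrow> bool" where
  "active v \<longleftrightarrow> idx v < k \<or> csize v \<le> idx v + k"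

definition rank :: "nat \<Rightarrow> nat" where
  "rank v = card {u. u < n \<and> u < v \<and> active u}"

definition dim :: nat where
  "dim = card {u. u < n \<and> active u}"

text \<open>The number \<open>S\<close> stands for a vertex set: its bits tell which active vertices belong to it.\<close>

definition mem :: "nat \<Rightarrow> nat \<Rightarrow> bool" where
  "mem S v \<longleftrightarrow> active v \<and> odd (S div 2 ^ rank v) \<or> \<not> active v \<and> s v"

end

subsection \<open>Properties of vertex sets as bounded formulas\<close>

definition def_fm :: "nat \<Rightarrow> (nat \<Rightarrow> nat \<Rightarrow> bool) \<Rightarrow> (nat \<Rightarrow> bool) \<Rightarrow> bool" where
  "def_fm n E A \<longleftrightarrow> (\<forall>v<n. A v \<longrightarrow>
     card {u. u < n \<and> E u v \<and> \<not> A u} \<le> Suc (card {u. u < n \<and> E u v \<and> A u}))"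

definition off_fm :: "nat \<Rightarrow> (nat \<Rightarrow> nat \<Rightarrow> bool) \<Rightarrow> (nat \<Rightarrow> bool) \<Rightarrow> bool" where
  "off_fm n E A \<longleftrightarrow> (\<forall>v<n. \<not> A v \<and> (\<exists>u<n. A u \<and> E u v) \<longrightarrow>
     card {u. u < n \<and> E u v \<and> \<not> A u} < card {u. u < n \<and> E u v \<and> A u})"

definition dom_fm :: "nat \<Rightarrow> (nat \<Rightarrow> nat \<Rightarrow> bool) \<Rightarrow> (nat \<Rightarrow> bool) \<Rightarrow> bool" where
  "dom_fm n E A \<longleftrightarrow> (\<forall>v<n. A v \<or> (\<exists>u<n. A u \<and> E u v))"

definition indep_fm :: "nat \<Rightarrow> (nat \<Rightarrow> nat \<Rightarrow> bool) \<Rightarrow> (nat \<Rightarrow> bool) \<Rightarrow> bool" where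
  "indep_fm n E A \<longleftrightarrow> (\<forall>u<n. \<forall>v<n. A u \<longrightarrow> A v \<longrightarrow> \<not> E u v)"

definition valid_fm ::
    "alliance \<Rightarrow> token_model \<Rightarrow> nat \<Rightarrow> (nat \<Rightarrow> nat \<Rightarrow> bool) \<Rightarrow> nat \<Rightarrow> (nat \<Rightarrow> bool) \<Rightarrow> bool" where
  "valid_fm Z TM n E h A \<longleftrightarrow>
     (Z \<in> {DA, G_DA, PA, G_PA} \<longrightarrow> def_fm n E A) \<and>
     (Z \<in> {OA, G_OA, Idp_OA, PA, G_PA} \<longrightarrow> off_fm n E A) \<and>
     (Z \<in> {G_DA, G_OA, G_PA} \<longrightarrow> dom_fm n E A) \<and>
     (Z = Idp_OA \<longrightarrow> indep_fm n E A) \<and>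
     (TM = TAR \<longrightarrow> card {v. v < n \<and> A v} \<le> h)"

definition step_fm :: "token_model \<Rightarrow> nat \<Rightarrow> (nat \<Rightarrow> nat \<Rightarrow> bool) \<Rightarrow> (nat \<Rightarrow> bool) \<Rightarrow> (nat \<Rightarrow> bool) \<Rightarrow> bool"
  where
  "step_fm TM n E A B \<longleftrightarrow>
     (TM = TAR \<longrightarrow>
        card {v. v < n \<and> A v \<and> \<not> B v} + card {v. v < n \<and> B v \<and> \<not> A v} = 1) \<and>
     (TM \<noteq> TAR \<longrightarrow>
        card {v. v < n \<and> A v \<and> \<not> B v} = 1 \<and> card {v. v < n \<and> B v \<and> \<not> A v} = 1) \<and>
     (TM = TS \<longrightarrow> (\<exists>u<n. \<exists>v<n. A u \<and> \<not> B u \<and> B v \<and> \<not> A v \<and> E u v))"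

subsection \<open>Breadth-first search on sets coded by numbers\<close>

text \<open>
  A set of numbers below \<open>N\<close> is coded by a single number with \<open>N\<close> bits.  The exponents are capped
  by \<open>N\<close> only to bound the running time for every value of \<open>S\<close>.
\<close>

definition elt :: "nat \<Rightarrow> nat \<Rightarrow> nat \<Rightarrow> bool" where
  "elt N R S \<longleftrightarrow> odd (R div 2 ^ min S N)"

definition code_set :: "nat \<Rightarrow> (nat \<Rightarrow> bool) \<Rightarrow> nat" where
  "code_set N P = (\<Sum>S<N. if P S then 2 ^ min S N else 0)"

definition reach_code :: "nat \<Rightarrow> (nat \<Rightarrow> bool) \<Rightarrow> (nat \<Rightarrow> nat \<Rightarrow> bool) \<Rightarrow> nat \<Rightarrow> nat" where
  "reach_code N I Q r = rec_nat (code_set N I)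
     (\<lambda>_ R. code_set N (\<lambda>S. elt N R S \<or> (\<exists>S'<N. elt N R S' \<and> Q S' S))) r"

definition search ::
    "alliance \<Rightarrow> token_model \<Rightarrow> nat \<Rightarrow> (nat \<Rightarrow> nat \<Rightarrow> bool) \<Rightarrow> nat \<Rightarrow> (nat \<Rightarrow> bool) \<Rightarrow> (nat \<Rightarrow> bool) \<Rightarrow>
     nat \<Rightarrow> (nat \<Rightarrow> nat \<Rightarrow> bool) \<Rightarrow> nat \<Rightarrow> bool" where
  "search Z TM n E h s t N m r \<longleftrightarrow> (\<exists>S<N.
     elt N (reach_code N (\<lambda>S. valid_fm Z TM n E h (m S) \<and> (\<forall>v<n. m S v \<longleftrightarrow> s v))
       (\<lambda>S' S. valid_fm Z TM n E h (m S) \<and> step_fm TM n E (m S') (m S)) r) S \<and>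
     (\<forall>v<n. m S v \<longleftrightarrow> t v))"

subsection \<open>Reading the instance\<close>

text \<open>Letter number \<open>i\<close> of the input is found in cell \<open>Suc i\<close>.\<close>

definition block_length :: "(nat \<Rightarrow> nat) \<Rightarrow> nat \<Rightarrow> nat" where
  "block_length M i = card {j. j < M 0 \<and> (\<forall>l<M 0. l \<le> j \<longrightarrow> i + l < M 0 \<and> M (Suc (i + l)) \<noteq> 2)}"

text \<open>The exponent stays \<open>j\<close>, since a block is no longer than the word; the cap
  by \<open>M 0\<close> displays a bound that \<open>bnd_min2\<close> can read off.\<close>

definition bin_val :: "(nat \<Rightarrow> nat) \<Rightarrow> nat \<Rightarrow> nat" where
  "bin_val M i = (\<Sum>j<block_length M i. if M (Suc (i + j)) = 1 then 2 ^ min j (M 0) else 0)"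

definition the_order :: "(nat \<Rightarrow> nat) \<Rightarrow> nat" where
  "the_order M = block_length M 0"

definition the_src :: "(nat \<Rightarrow> nat) \<Rightarrow> nat \<Rightarrow> bool" where
  "the_src M v \<longleftrightarrow> v < the_order M \<and> M (Suc v) = 1"

definition the_tgt :: "(nat \<Rightarrow> nat) \<Rightarrow> nat \<Rightarrow> bool" where
  "the_tgt M v \<longleftrightarrow> v < the_order M \<and> M (Suc (Suc (the_order M + v))) = 1"

definition the_adj :: "(nat \<Rightarrow> nat) \<Rightarrow> nat \<Rightarrow> nat \<Rightarrow> bool" where
  "the_adj M u v \<longleftrightarrow> u < the_order M \<and> v < the_order M \<and>
     M (Suc (Suc (Suc (the_order M + the_order M + (u * the_order M + v))))) = 1"

text \<open>A letter number, not a cell: two characteristic vectors, the matrix and three separators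
  precede the first binary number.\<close>

definition thr_pos :: "(nat \<Rightarrow> nat) \<Rightarrow> nat" where
  "thr_pos M = Suc (Suc (Suc (the_order M + the_order M + the_order M * the_order M)))"

definition len_pos :: "token_model \<Rightarrow> (nat \<Rightarrow> nat) \<Rightarrow> nat" where
  "len_pos TM M = (if TM = TAR then Suc (thr_pos M + block_length M (thr_pos M)) else thr_pos M)"

definition the_thr :: "(nat \<Rightarrow> nat) \<Rightarrow> nat" where
  "the_thr M = bin_val M (thr_pos M)"

definition the_len :: "token_model \<Rightarrow> (nat \<Rightarrow> nat) \<Rightarrow> nat" where
  "the_len TM M = bin_val M (len_pos TM M)"

definition the_par :: "token_model \<Rightarrow> par \<Rightarrow> (nat \<Rightarrow> nat) \<Rightarrow> nat" where
  "the_par TM p M = (if p = Length then the_len TM M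
     else if TM = TAR then the_thr M else card {v. v < the_order M \<and> the_src M v})"

abbreviation the_dim :: "token_model \<Rightarrow> par \<Rightarrow> (nat \<Rightarrow> nat) \<Rightarrow> nat" where
  "the_dim TM p M \<equiv>
     reconf_data.dim (the_order M) (the_adj M) (the_src M) (the_tgt M) (the_par TM p M)"

abbreviation the_mem :: "token_model \<Rightarrow> par \<Rightarrow> (nat \<Rightarrow> nat) \<Rightarrow> nat \<Rightarrow> nat \<Rightarrow> bool" where
  "the_mem TM p M \<equiv>
     reconf_data.mem (the_order M) (the_adj M) (the_src M) (the_tgt M) (the_par TM p M)"

text \<open>A sequence of \<open>len\<close> sets has \<open>len - 1\<close> steps, and the test
  \<open>0 < len\<close> guards this cut-off subtraction. As \<open>len\<close> is given in binary,
  the rounds are capped by the square of the number of states, enough by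
  \<open>relpow_bounded_below\<close>.\<close>

definition answer :: "alliance \<Rightarrow> token_model \<Rightarrow> bool \<Rightarrow> par \<Rightarrow> (nat \<Rightarrow> nat) \<Rightarrow> bool" where
  "answer Z TM timed p M \<longleftrightarrow> (timed \<longrightarrow> 0 < the_len TM M) \<and>
     search Z TM (the_order M) (the_adj M) (the_thr M) (the_src M) (the_tgt M)
       (2 ^ the_dim TM p M) (the_mem TM p M)
       (if timed then min (the_len TM M - 1) (2 ^ the_dim TM p M * 2 ^ the_dim TM p M)
        else 2 ^ the_dim TM p M * 2 ^ the_dim TM p M)"

text \<open>The measure in which the decision procedure is polynomial; the parameter enters the
  running time only through its second summand.\<close>

definition space :: "token_model \<Rightarrow> par \<Rightarrow> (nat \<Rightarrow> nat) \<Rightarrow> nat" where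
  "space TM p M = M 0 + 2 ^ the_dim TM p M"

subsection \<open>The algorithm is polynomial in the number of states\<close>

lemma card_less_conj_le: "card {i. i < (k::nat) \<and> P i} \<le> k"
proof -
  have "card {i. i < k \<and> P i} \<le> card {..<k}" by (rule card_mono) auto
  then show ?thesis by simp
qed

lemma the_order_le: "the_order M \<le> M 0"
  unfolding the_order_def block_length_def by (rule card_less_conj_le)

context
  fixes G :: "(nat \<Rightarrow> nat) \<Rightarrow> nat"
  assumes G: "\<And>M. M 0 \<le> G M"
begin

lemma bnd_0: "bnd G (\<lambda>M e. M 0)"
  by (rule bndI) (rule G)

lemma bnd_block_length: "bnd G (\<lambda>M e. block_length M (f M e))"
  unfolding block_length_def by (rule bndI, rule order_trans[OF card_less_conj_le G])

lemma bnd_order: "bnd G (\<lambda>M e. the_order M)"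
  unfolding the_order_def by (rule bnd_block_length)

lemma polytime_0: "polytime G (\<lambda>M e. M 0)"
  by (intro polytime_rules)

lemma polytime_block_length: "polytime G f \<Longrightarrow> polytime G (\<lambda>M e. block_length M (f M e))"
  by (erule polytime_app1[rotated]) (unfold block_length_def, intro polytime_rules polytime_0 bnd_0)

lemma polytime_bin_val: "polytime G f \<Longrightarrow> polytime G (\<lambda>M e. bin_val M (f M e))"
  by (erule polytime_app1[rotated]) (unfold bin_val_def,
      intro polytime_rules polytime_0 polytime_sum polytime_pow2 polytime_block_length bnd_block_length bnd_min2 bnd_0)

lemma polytime_order: "polytime G (\<lambda>M e. the_order M)"
  unfolding the_order_def by (intro polytime_rules polytime_block_length)

lemma polytimeB_src: "polytime G f \<Longrightarrow> polytimeB G (\<lambda>M e. the_src M (f M e))"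
  unfolding the_src_def by (intro polytime_rules polytime_order)

lemma polytimeB_tgt: "polytime G f \<Longrightarrow> polytimeB G (\<lambda>M e. the_tgt M (f M e))"
  unfolding the_tgt_def by (intro polytime_rules polytime_order)

lemma polytimeB_adj: "polytime G f \<Longrightarrow> polytime G g \<Longrightarrow> polytimeB G (\<lambda>M e. the_adj M (f M e) (g M e))"
  unfolding the_adj_def by (intro polytime_rules polytime_order polytime_mult bnd_order)

lemma polytime_thr_pos: "polytime G (\<lambda>M e. thr_pos M)"
  unfolding thr_pos_def by (intro polytime_rules polytime_order polytime_mult bnd_order)

lemma polytime_thr: "polytime G (\<lambda>M e. the_thr M)"
  unfolding the_thr_def by (intro polytime_bin_val polytime_thr_pos)

lemma polytime_len: "polytime G (\<lambda>M e. the_len TM M)"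
  unfolding the_len_def len_pos_def by (intro polytime_rules polytime_bin_val polytime_thr_pos polytime_block_length)

lemma polytime_par: "polytime G (\<lambda>M e. the_par TM p M)"
  unfolding the_par_def by (intro polytime_rules polytime_len polytime_thr polytime_order polytimeB_src bnd_order)

lemmas graph_rules = polytime_rules polytime_order bnd_order polytimeB_src polytimeB_tgt polytimeB_adj polytime_par

lemma polytimeB_eqv: "polytime G f \<Longrightarrow> polytime G g \<Longrightarrow>
    polytimeB G (\<lambda>M e. reconf_data.eqv (the_order M) (the_adj M) (the_src M) (the_tgt M) (f M e) (g M e))"
  by (erule (1) polytimeB_app2[rotated]) (unfold reconf_data.eqv_def, intro graph_rules)

lemma polytime_idx: "polytime G f \<Longrightarrow>
    polytime G (\<lambda>M e. reconf_data.idx (the_order M) (the_adj M) (the_src M) (the_tgt M) (f M e))"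
  by (erule polytime_app1[rotated]) (unfold reconf_data.idx_def, intro graph_rules polytimeB_eqv)

lemma polytime_csize: "polytime G f \<Longrightarrow>
    polytime G (\<lambda>M e. reconf_data.csize (the_order M) (the_adj M) (the_src M) (the_tgt M) (f M e))"
  by (erule polytime_app1[rotated]) (unfold reconf_data.csize_def, intro graph_rules polytimeB_eqv)

lemma polytimeB_active: "polytime G f \<Longrightarrow> polytimeB G (\<lambda>M e.
    reconf_data.active (the_order M) (the_adj M) (the_src M) (the_tgt M) (the_par TM p M) (f M e))"
  unfolding reconf_data.active_def by (intro graph_rules polytime_idx polytime_csize)

lemma polytime_rank: "polytime G f \<Longrightarrow> polytime G (\<lambda>M e.
    reconf_data.rank (the_order M) (the_adj M) (the_src M) (the_tgt M) (the_par TM p M) (f M e))"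
  by (erule polytime_app1[rotated]) (unfold reconf_data.rank_def, intro graph_rules polytimeB_active)

lemma bnd_rank: "bnd G (\<lambda>M e.
    reconf_data.rank (the_order M) (the_adj M) (the_src M) (the_tgt M) (the_par TM p M) (f M e))"
  unfolding reconf_data.rank_def
  by (rule bndI, rule order_trans[OF order_trans[OF card_less_conj_le the_order_le] G])

lemma polytime_dim: "polytime G (\<lambda>M e. the_dim TM p M)"
  unfolding reconf_data.dim_def by (intro graph_rules polytimeB_active)

lemma bnd_dim: "bnd G (\<lambda>M e. the_dim TM p M)"
  unfolding reconf_data.dim_def
  by (rule bndI, rule order_trans[OF order_trans[OF card_less_conj_le the_order_le] G])

lemma polytimeB_mem: "polytime G f \<Longrightarrow> polytime G g \<Longrightarrow> polytimeB G (\<lambda>M e. the_mem TM p M (f M e) (g M e))"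
  unfolding reconf_data.mem_def
  by (intro graph_rules polytimeB_active polytimeB_odd polytime_div_pow2 polytime_rank bnd_rank)

lemma polytime_states: "polytime G (\<lambda>M e. 2 ^ the_dim TM p M)"
  by (intro polytime_pow2 polytime_dim bnd_dim)

lemma polytimeB_valid:
  "polytime G f \<Longrightarrow> polytimeB G (\<lambda>M e. valid_fm Z TM (the_order M) (the_adj M) (the_thr M) (the_mem TM p M (f M e)))"
  by (erule polytimeB_app1[rotated])
    (unfold valid_fm_def def_fm_def off_fm_def dom_fm_def indep_fm_def,
     intro graph_rules polytimeB_mem polytime_thr)

lemma polytimeB_step: "polytime G f \<Longrightarrow> polytime G g \<Longrightarrow>
    polytimeB G (\<lambda>M e. step_fm TM (the_order M) (the_adj M) (the_mem TM p M (f M e)) (the_mem TM p M (g M e)))"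
  by (rule polytimeB_app2[where P = "\<lambda>M x y. step_fm TM (the_order M) (the_adj M)
        (the_mem TM p M x) (the_mem TM p M y)"])
    (unfold step_fm_def, intro graph_rules polytimeB_mem)

text \<open>All loops run up to a quantity below the input length, the number of states, or its
  square. The number of states is the one bound that does not follow from
  \<open>M 0 \<le> G M\<close>.\<close>

lemma polytimeB_answer:
  assumes bnd_states: "bnd G (\<lambda>M e. 2 ^ the_dim TM p M)"
  shows "polytimeB G (\<lambda>M e. answer Z TM timed p M)"
proof -
  note rules = graph_rules polytimeB_mem polytime_states bnd_states polytimeB_valid polytimeB_step polytime_len
  have elt: "polytimeB G (\<lambda>M e. elt (2 ^ the_dim TM p M) (f M e) (g M e))"
    if "polytime G f" "polytime G g" for f g
    unfolding elt_def by (intro rules polytimeB_odd polytime_div_pow2 bnd_min2 that)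
  have code: "polytime G (\<lambda>M e. code_set (2 ^ the_dim TM p M) (\<lambda>S. P M S e))"
    if "polytimeB G (\<lambda>M e. P M (hd e) (tl e))" for P
    unfolding code_set_def by (intro rules polytime_sum polytime_pow2 bnd_min2 that)
  have rounds: "polytime G (\<lambda>M e. if timed
        then min (the_len TM M - 1) (2 ^ the_dim TM p M * 2 ^ the_dim TM p M)
        else 2 ^ the_dim TM p M * 2 ^ the_dim TM p M)"
    by (intro rules polytime_mult)
  have bnd_rounds: "bnd G (\<lambda>M e. if timed
        then min (the_len TM M - 1) (2 ^ the_dim TM p M * 2 ^ the_dim TM p M)
        else 2 ^ the_dim TM p M * 2 ^ the_dim TM p M)"
    using bnd_min2[OF bnd_mult[OF bnd_states bnd_states]] bnd_mult[OF bnd_states bnd_states]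
    by (cases timed) simp_all
  show ?thesis
    unfolding answer_def search_def reach_code_def
    by (intro rules elt code polytime_rec_nat rounds bnd_rounds)
qed

end

lemma polytimeB_answer_space: "polytimeB (space TM p) (\<lambda>M e. answer Z TM timed p M)"
  by (intro polytimeB_answer bndI) (simp_all add: space_def)

section \<open>The memory image of an encoded word determines the instance\<close>

section \<open>Decoding an encoded instance\<close>

abbreviation memory :: "symb list \<Rightarrow> nat \<Rightarrow> nat" where
  "memory w \<equiv> snd (input w)"

lemma memory_0 [simp]: "memory w 0 = length w"
  by (simp add: input_def)

lemma memory_Suc: "memory w (Suc i) = (if i < length w then code (w ! i) else 0)"
  by (simp add: input_def)

lemma code_le: "code b \<le> 2"
  by (cases b rule: code.cases) auto

lemma code_eq [simp]: "code b = 2 \<longleftrightarrow> b = Sep" "code b = Suc 0 \<longleftrightarrow> b = Bit True"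
  by (cases b rule: code.cases; simp)+

lemma small_memory: "small (memory w)"
  unfolding small_def
proof (intro allI impI)
  fix i :: nat
  assume "i > 0"
  then obtain j where "i = Suc j" by (cases i) auto
  then show "memory w i < 4" using code_le[of "w ! j"] by (simp add: memory_Suc)
qed

lemma block_length_memory:
  assumes w: "w = u @ bs @ rest" and bs: "Sep \<notin> set bs" and rest: "rest = [] \<or> hd rest = Sep"
  shows "block_length (memory w) (length u) = length bs"
proof -
  have "{j. j < length w \<and> (\<forall>l<length w. l \<le> j \<longrightarrow>
      length u + l < length w \<and> memory w (Suc (length u + l)) \<noteq> 2)} = {..<length bs}"
    (is "?A = _")
  proof (intro equalityI subsetI)
    fix j assume j: "j \<in> ?A"
    show "j \<in> {..<length bs}"
    proof (rule ccontr)
      assume "j \<notin> {..<length bs}"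
      \<comment> \<open>The condition for \<open>l = length bs\<close> demands a letter other than
        \<open>Sep\<close> directly after the block.\<close>
      then have "length u + length bs < length w \<and> memory w (Suc (length u + length bs)) \<noteq> 2"
        using j by auto
      then have "rest \<noteq> []" "hd rest \<noteq> Sep"
        by (auto simp: w memory_Suc nth_append hd_conv_nth)
      with rest show False by blast
    qed
  next
    fix j assume "j \<in> {..<length bs}"
    then have j: "j < length bs" by simp
    have "memory w (Suc (length u + l)) \<noteq> 2" if "l \<le> j" for l
    proof -
      have "w ! (length u + l) = bs ! l" using j that by (simp add: w nth_append)
      moreover have "bs ! l \<noteq> Sep" using bs j that by (metis nth_mem order_le_less_trans)
      ultimately show ?thesis by (simp add: memory_Suc)
    qed
    with j show "j \<in> ?A" by (auto simp: w)
  qed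
  then show ?thesis by (simp add: block_length_def)
qed

lemma Sep_notin_bin: "Sep \<notin> set (bin n)"
  by (induction n rule: bin.induct) (subst bin.simps, auto)

lemma sum_bin: "(\<Sum>j<length (bin n). if bin n ! j = Bit True then 2 ^ j else 0) = n"
proof (induction n rule: bin.induct)
  case (1 n)
  show ?case
  proof (cases "n = 0")
    case True
    then show ?thesis by (simp add: bin.simps)
  next
    case False
    have b: "bin n = Bit (odd n) # bin (n div 2)" using False by (subst bin.simps) simp
    have "(\<Sum>j<length (bin n). if bin n ! j = Bit True then 2 ^ j else 0) =
        of_bool (odd n) + (\<Sum>j<length (bin (n div 2)). if bin (n div 2) ! j = Bit True then 2 ^ Suc j else 0)"
      unfolding b by (simp add: sum.lessThan_Suc_shift del: sum.lessThan_Suc power_Suc)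
    also have "(\<Sum>j<length (bin (n div 2)). if bin (n div 2) ! j = Bit True then 2 ^ Suc j else 0) =
        2 * (\<Sum>j<length (bin (n div 2)). if bin (n div 2) ! j = Bit True then 2 ^ j else (0::nat))"
      unfolding sum_distrib_left by (rule sum.cong) auto
    also have "\<dots> = 2 * (n div 2)" using 1[OF False] by simp
    finally show ?thesis by simp
  qed
qed

lemma bin_val_memory:
  assumes "w = u @ bin n @ rest" "rest = [] \<or> hd rest = Sep"
  shows "bin_val (memory w) (length u) = n"
proof -
  have "bin_val (memory w) (length u) =
      (\<Sum>j<length (bin n). if bin n ! j = Bit True then 2 ^ j else 0)"
    unfolding bin_val_def block_length_memory[OF assms(1) Sep_notin_bin assms(2)]
    by (rule sum.cong) (auto simp: assms(1) memory_Suc nth_append)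
  then show ?thesis by (simp add: sum_bin)
qed

lemma length_char_vec [simp]: "length (char_vec n A) = n"
  by (simp add: char_vec_def)

lemma nth_char_vec [simp]: "i < n \<Longrightarrow> char_vec n A ! i = Bit (i \<in> A)"
  by (simp add: char_vec_def)

lemma Sep_notin_char_vec: "Sep \<notin> set (char_vec n A)"
  by (auto simp: char_vec_def)

definition rows :: "nat \<Rightarrow> (nat \<Rightarrow> nat set) \<Rightarrow> nat \<Rightarrow> symb list" where
  "rows n f m = concat (map (\<lambda>i. char_vec n (f i)) [0..<m])"

lemma length_rows [simp]: "length (rows n f m) = m * n"
  by (induction m) (auto simp: rows_def)

lemma nth_rows: "u < m \<Longrightarrow> v < n \<Longrightarrow> rows n f m ! (u * n + v) = Bit (v \<in> f u)"
proof (induction m)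
  case (Suc m)
  have eq: "rows n f (Suc m) = rows n f m @ char_vec n (f m)" by (simp add: rows_def)
  show ?case
  proof (cases "u < m")
    case True
    have "u * n + v < Suc u * n" using Suc.prems by simp
    also have "\<dots> \<le> m * n" using True by (intro mult_le_mono1) simp
    finally show ?thesis using Suc True by (simp add: eq nth_append)
  next
    case False
    then have "u = m" using Suc.prems by simp
    then show ?thesis using Suc.prems by (simp add: eq nth_append)
  qed
qed simp

context
  fixes TM :: token_model and timed :: bool and x :: reconf_inst and w :: "symb list" and tl1 tl2
  assumes x: "x \<in> instances"
  defines "w \<equiv> reconf_enc TM timed x"
  defines "tl1 \<equiv> if TM = TAR then Sep # bin (thr x) else []"
  defines "tl2 \<equiv> if timed then Sep # bin (len x) else []"
begin

lemma word_eq: "w = char_vec (order x) (src x) @ Sep # char_vec (order x) (tgt x) @ Sep #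
    rows (order x) (nbrs (adj x)) (order x) @ tl1 @ tl2"
  by (simp add: w_def tl1_def tl2_def reconf_enc_def rows_def)

lemma the_order_memory: "the_order (memory w) = order x"
  using block_length_memory[of w "[]", OF _ Sep_notin_char_vec] word_eq
  unfolding the_order_def by fastforce

lemma the_src_memory: "the_src (memory w) v \<longleftrightarrow> v \<in> src x"
proof (cases "v < order x")
  case True
  then have "memory w (Suc v) = code (Bit (v \<in> src x))"
    by (simp add: word_eq memory_Suc nth_append)
  with True show ?thesis by (simp add: the_src_def the_order_memory)
next
  case False
  then show ?thesis using x by (auto simp: the_src_def the_order_memory instances_def)
qed

lemma the_tgt_memory: "the_tgt (memory w) v \<longleftrightarrow> v \<in> tgt x"
proof (cases "v < order x")
  case True
  then have "memory w (Suc (Suc (order x + v))) = code (Bit (v \<in> tgt x))"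
    by (simp add: word_eq memory_Suc nth_append nth_Cons')
  with True show ?thesis by (simp add: the_tgt_def the_order_memory)
next
  case False
  then show ?thesis using x by (auto simp: the_tgt_def the_order_memory instances_def)
qed

lemma the_adj_memory: "the_adj (memory w) u v \<longleftrightarrow> adj x u v"
proof (cases "u < order x \<and> v < order x")
  case True
  have "u * order x + v < Suc u * order x" using True by simp
  also have "\<dots> \<le> order x * order x" using True by (intro mult_le_mono1) simp
  finally have "memory w (Suc (Suc (Suc (order x + order x + (u * order x + v))))) =
      code (rows (order x) (nbrs (adj x)) (order x) ! (u * order x + v))"
    by (simp add: word_eq memory_Suc nth_append nth_Cons')
  also have "\<dots> = code (Bit (adj x u v))" using True by (simp add: nth_rows nbrs_def)
  finally show ?thesis using True by (simp add: the_adj_def the_order_memory)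
next
  case False
  then show ?thesis using x
    by (auto simp: the_adj_def the_order_memory instances_def sgraph_def)
qed

lemma thr_pos_memory: "thr_pos (memory w) = Suc (Suc (Suc (order x + (order x + order x * order x))))"
  by (simp add: thr_pos_def the_order_memory)

lemma the_thr_memory:
  assumes "TM = TAR"
  shows "the_thr (memory w) = thr x"
proof -
  let ?u = "char_vec (order x) (src x) @ Sep # char_vec (order x) (tgt x) @ Sep #
    rows (order x) (nbrs (adj x)) (order x) @ [Sep]"
  have "w = ?u @ bin (thr x) @ tl2" using assms by (simp add: word_eq tl1_def)
  from bin_val_memory[OF this] show ?thesis
    unfolding the_thr_def thr_pos_memory by (auto simp: tl2_def)
qed

lemma the_len_memory:
  assumes "timed"
  shows "the_len TM (memory w) = len x"
proof -
  let ?u = "char_vec (order x) (src x) @ Sep # char_vec (order x) (tgt x) @ Sep #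
    rows (order x) (nbrs (adj x)) (order x) @ tl1 @ [Sep]"
  have w1: "w = ?u @ bin (len x) @ []" using assms by (simp add: word_eq tl2_def)
  have "length ?u = len_pos TM (memory w)"
  proof (cases "TM = TAR")
    case True
    let ?v = "char_vec (order x) (src x) @ Sep # char_vec (order x) (tgt x) @ Sep #
      rows (order x) (nbrs (adj x)) (order x) @ [Sep]"
    have "w = ?v @ bin (thr x) @ tl2" using True by (simp add: word_eq tl1_def)
    from block_length_memory[OF this Sep_notin_bin]
    have "block_length (memory w) (thr_pos (memory w)) = length (bin (thr x))"
      unfolding thr_pos_memory by (auto simp: tl2_def)
    with True show ?thesis by (simp add: len_pos_def tl1_def thr_pos_memory)
  next
    case False
    then show ?thesis by (simp add: len_pos_def tl1_def thr_pos_memory)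
  qed
  with bin_val_memory[OF w1] show ?thesis by (simp add: the_len_def)
qed

text \<open>The premise reflects the encoding: the length bound is part of the word only in the
  timed version.\<close>

lemma the_par_memory:
  assumes "p = Length \<Longrightarrow> timed"
  shows "the_par TM p (memory w) = par_val TM p x"
proof -
  have "{v. v < order x \<and> v \<in> src x} = src x" using x by (auto simp: instances_def)
  with assms show ?thesis
    by (cases p) (auto simp: the_par_def the_len_memory the_thr_memory the_order_memory the_src_memory)
qed

lemma length_word: "2 \<le> length w"
  by (simp add: word_eq)

end

section \<open>Twin exchanges and canonical sets\<close>

section \<open>Invariance under automorphisms\<close>

locale graph_auto =
  fixes V :: "'a set" and E :: "'a \<Rightarrow> 'a \<Rightarrow> bool" and \<pi> :: "'a \<Rightarrow> 'a"
  assumes graph: "sgraph V E" and bij: "bij \<pi>" and V: "\<pi> ` V = V"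
    and E: "E (\<pi> u) (\<pi> v) \<longleftrightarrow> E u v"
begin

lemma nbrs_image: "nbrs E (\<pi> v) = \<pi> ` nbrs E v"
proof -
  have "u \<in> \<pi> ` nbrs E v" if "E (\<pi> v) u" for u
  proof -
    obtain u' where "u = \<pi> u'" using bij by (metis bij_pointE)
    with that show ?thesis by (simp add: E nbrs_def)
  qed
  then show ?thesis by (auto simp: nbrs_def E)
qed

lemma inj: "inj \<pi>"
  using bij by (rule bij_is_inj)

lemma deg_in_image: "deg_in E (\<pi> ` A) (\<pi> v) = deg_in E A v"
  unfolding deg_in_def nbrs_image image_Int[OF inj, symmetric]
  by (rule card_image) (rule inj_on_subset[OF inj subset_UNIV])

lemma Diff_image: "V - \<pi> ` A = \<pi> ` (V - A)"
  using V by (metis image_set_diff inj)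

lemma closed_nbrs_image: "closed_nbrs E (\<pi> ` A) = \<pi> ` closed_nbrs E A"
  unfolding closed_nbrs_def by (auto simp: nbrs_image)

text \<open>All seven properties are built from degrees into a set, complements, closed
  neighborhoods and adjacency, which commute with \<open>\<pi>\<close>.\<close>

lemma has_prop_image: "has_prop Z V E A \<Longrightarrow> has_prop Z V E (\<pi> ` A)"
proof -
  assume A: "has_prop Z V E A"
  have "defensive V E A \<Longrightarrow> defensive V E (\<pi> ` A)"
    by (auto simp: defensive_def Diff_image deg_in_image)
  moreover have "offensive V E A \<Longrightarrow> offensive V E (\<pi> ` A)"
    by (auto simp: offensive_def boundary_def closed_nbrs_image Diff_image deg_in_image
        image_set_diff[OF inj, symmetric])
  moreover have "dominating V E A \<Longrightarrow> dominating V E (\<pi> ` A)"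
    by (simp add: dominating_def closed_nbrs_image V)
  moreover have "independent E A \<Longrightarrow> independent E (\<pi> ` A)"
    by (auto simp: independent_def E)
  moreover have "A \<subseteq> V \<Longrightarrow> \<pi> ` A \<subseteq> V" using V by blast
  ultimately show ?thesis using A by (cases Z) auto
qed

end

section \<open>Ranks\<close>

text \<open>Serves two numberings: positions within a class (\<open>idx\<close>) and bit positions
  of active vertices (\<open>rank\<close>).\<close>

lemma inj_on_rank: "finite T \<Longrightarrow> inj_on (\<lambda>v. card {u \<in> T. u < v}) (T :: nat set)"
proof (rule inj_onI, rule ccontr)
  fix u v assume T: "finite T" "u \<in> T" "v \<in> T" "card {w \<in> T. w < u} = card {w \<in> T. w < v}" "u \<noteq> v"
  have "card {w \<in> T. w < x} < card {w \<in> T. w < y}" if "x < y" "x \<in> T" for x y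
    by (rule psubset_card_mono) (use that T in auto)
  then show False using T by (cases u v rule: linorder_cases) fastforce+
qed

lemma rank_image: "finite T \<Longrightarrow> (\<lambda>v. card {u \<in> T. u < v}) ` T = {..<card (T :: nat set)}"
proof (rule card_subset_eq)
  assume T: "finite T"
  have "card {u \<in> T. u < v} < card T" if "v \<in> T" for v
    by (rule psubset_card_mono) (use that T in auto)
  then show "(\<lambda>v. card {u \<in> T. u < v}) ` T \<subseteq> {..<card T}" by auto
  show "card ((\<lambda>v. card {u \<in> T. u < v}) ` T) = card {..<card T}"
    using card_image[OF inj_on_rank[OF T]] by simp
qed simp

section \<open>Equivalent vertices\<close>

locale reconf_graph = reconf_data +
  assumes graph: "sgraph {..<n} E"
begin

abbreviation V :: "nat set" where "V \<equiv> {..<n}"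

lemma E_sym: "E u v \<Longrightarrow> E v u" and E_irrefl: "\<not> E v v" and E_less: "E u v \<Longrightarrow> u < n \<and> v < n"
  using graph by (auto simp: sgraph_def)

lemma eqv_iff:
  "eqv u v \<longleftrightarrow> (\<forall>x. x \<noteq> u \<and> x \<noteq> v \<longrightarrow> (E u x \<longleftrightarrow> E v x)) \<and> (s u \<longleftrightarrow> s v) \<and> (t u \<longleftrightarrow> t v)"
proof -
  have "(\<forall>x<n. (E u x \<and> x \<noteq> v) \<longleftrightarrow> (E v x \<and> x \<noteq> u)) \<longleftrightarrow>
      (\<forall>x. x \<noteq> u \<and> x \<noteq> v \<longrightarrow> (E u x \<longleftrightarrow> E v x))" (is "?L \<longleftrightarrow> ?R")
  proof
    assume L: ?L
    show ?R
    proof (intro allI impI)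
      fix x assume "x \<noteq> u \<and> x \<noteq> v"
      then show "E u x \<longleftrightarrow> E v x" using L E_less[of u x] E_less[of v x] by blast
    qed
  next
    assume R: ?R
    show ?L
    proof (intro allI impI)
      fix x
      show "(E u x \<and> x \<noteq> v) \<longleftrightarrow> (E v x \<and> x \<noteq> u)"
        using R E_irrefl[of u] E_irrefl[of v] by (cases "x = u \<or> x = v") auto
    qed
  qed
  then show ?thesis by (simp add: eqv_def)
qed

lemma eqv_refl [simp]: "eqv v v"
  by (simp add: eqv_iff)

lemma eqv_sym: "eqv u v \<Longrightarrow> eqv v u"
  by (auto simp: eqv_iff)

text \<open>The delicate case of the test vertex being \<open>v\<close> itself:
  \<open>E u v\<close>, \<open>E u w\<close> and \<open>E v w\<close> are equivalent, by using
  \<open>w\<close> to compare \<open>u, v\<close> and \<open>u\<close> to compare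
  \<open>v, w\<close>.\<close>

lemma eqv_trans: "eqv u v \<Longrightarrow> eqv v w \<Longrightarrow> eqv u w"
  unfolding eqv_iff using E_sym by metis

text \<open>Adjacency of distinct vertices depends only on their classes; within one class too, as
  it is a clique or independent.\<close>

lemma eqv_edge: "E u v \<Longrightarrow> eqv u u' \<Longrightarrow> eqv v v' \<Longrightarrow> u' \<noteq> v' \<Longrightarrow> E u' v'"
  unfolding eqv_iff using E_sym E_irrefl by metis

definition cls :: "nat \<Rightarrow> nat set" where
  "cls v = {u. u < n \<and> eqv u v}"

lemma finite_cls [simp]: "finite (cls v)"
  by (simp add: cls_def)

lemma cls_self: "v < n \<Longrightarrow> v \<in> cls v"
  by (simp add: cls_def)

lemma cls_eq: "eqv u v \<Longrightarrow> cls u = cls v"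
  unfolding cls_def using eqv_sym eqv_trans by blast

lemma csize_cls: "csize v = card (cls v)"
  by (simp add: csize_def cls_def)

lemma idx_cls: "u \<in> cls v \<Longrightarrow> idx u = card {w \<in> cls v. w < u}"
proof -
  assume "u \<in> cls v"
  then have "cls v = cls u" using cls_eq[of u v] by (simp add: cls_def)
  moreover have "{w \<in> cls u. w < u} = {w. w < n \<and> w < u \<and> eqv w u}" by (auto simp: cls_def)
  ultimately show ?thesis by (simp add: idx_def)
qed

lemma idx_inj: "inj_on idx (cls v)"
  using inj_on_rank[OF finite_cls, of v] idx_cls by (metis (no_types, lifting) inj_on_cong)

lemma idx_image: "idx ` cls v = {..<csize v}"
  using rank_image[OF finite_cls, of v] idx_cls by (simp add: csize_cls cong: image_cong)

lemma idx_less: "v < n \<Longrightarrow> idx v < csize v"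
  using idx_image[of v] by (auto simp: cls_def)

definition cnt :: "nat set \<Rightarrow> nat \<Rightarrow> nat" where
  "cnt A v = card (A \<inter> cls v)"

lemma cnt_eqv: "eqv u v \<Longrightarrow> cnt A u = cnt A v"
  by (simp add: cnt_def cls_eq)

lemma cnt_le: "cnt A v \<le> csize v"
  unfolding cnt_def csize_cls by (rule card_mono) auto

lemma cnt_insert: "u < n \<Longrightarrow> u \<notin> A \<Longrightarrow> cnt (insert u A) v = cnt A v + of_bool (eqv u v)"
  by (auto simp: cnt_def cls_def Int_insert_left)

definition canon :: "nat set \<Rightarrow> nat set" where
  "canon A = {v. v < n \<and> idx v < cnt A v}"

text \<open>\<open>idx\<close> maps \<open>canon A \<inter> cls v\<close> bijectively onto the
  numbers below \<open>cnt A v\<close>, all of which occur as indices by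
  \<open>cnt_le\<close>.\<close>

lemma cnt_canon: "cnt (canon A) v = cnt A v"
proof -
  have "idx ` (canon A \<inter> cls v) = {..<cnt A v}"
  proof -
    have "canon A \<inter> cls v = {u \<in> cls v. idx u < cnt A v}"
      by (auto simp: canon_def cls_def cnt_eqv)
    moreover have "\<dots> = cls v \<inter> idx -` {..<cnt A v}" by auto
    moreover have "idx ` (cls v \<inter> idx -` {..<cnt A v}) = idx ` cls v \<inter> {..<cnt A v}"
      by auto
    ultimately show ?thesis using cnt_le[of A v] by (auto simp: idx_image)
  qed
  moreover have "inj_on idx (canon A \<inter> cls v)"
    by (rule inj_on_subset[OF idx_inj[of v]]) blast
  ultimately show ?thesis unfolding cnt_def[of "canon A"]
    using card_image[of idx "canon A \<inter> cls v"] by simp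
qed

text \<open>This is what the refinement by \<open>s\<close> and \<open>t\<close> buys: each class
  lies entirely inside or outside the set, and both the full and the empty class are initial
  segments.\<close>

lemma canon_src: "canon {v. v < n \<and> s v} = {v. v < n \<and> s v}"
  and canon_tgt: "canon {v. v < n \<and> t v} = {v. v < n \<and> t v}"
proof -
  have *: "canon {v. v < n \<and> P v} = {v. v < n \<and> P v}" if P: "\<And>u v. eqv u v \<Longrightarrow> P u = P v" for P
  proof -
    have "cnt {v. v < n \<and> P v} v = (if P v then csize v else 0)" for v
    proof -
      have "{v. v < n \<and> P v} \<inter> cls v = (if P v then cls v else {})"
        using P by (auto simp: cls_def)
      then show ?thesis by (simp add: cnt_def csize_cls)
    qed
    then show ?thesis using idx_less by (auto simp: canon_def)
  qed
  show "canon {v. v < n \<and> s v} = {v. v < n \<and> s v}" "canon {v. v < n \<and> t v} = {v. v < n \<and> t v}"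
    by (rule *, simp add: eqv_iff)+
qed

text \<open>Only the class of \<open>v\<close> gains a token, so its segment grows by the vertex
  \<open>v'\<close> of index \<open>cnt A v\<close>; this vertex exists because \<open>v\<close>
  itself shows that the class is not full.\<close>

lemma canon_insert:
  assumes "v < n" "v \<notin> A"
  obtains v' where "v' < n" "eqv v v'" "v' \<notin> canon A" "canon (insert v A) = insert v' (canon A)"
proof -
  have "A \<inter> cls v \<subset> cls v" using assms cls_self[of v] by blast
  then have "cnt A v < csize v" unfolding cnt_def csize_cls by (rule psubset_card_mono[rotated]) simp
  then have "cnt A v \<in> idx ` cls v" by (simp add: idx_image)
  then obtain v' where v': "v' \<in> cls v" "idx v' = cnt A v" by auto
  have "canon (insert v A) = insert v' (canon A)"
  proof (rule set_eqI)
    fix u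
    show "u \<in> canon (insert v A) \<longleftrightarrow> u \<in> insert v' (canon A)"
    proof (cases "eqv v u")
      case True
      have "u = v'" if "u < n" "idx u = cnt A u"
        by (rule inj_onD[OF idx_inj[of v]])
          (use True v' that cnt_eqv[OF True, of A] eqv_sym in \<open>simp_all add: cls_def\<close>)
      then have "u = v' \<longleftrightarrow> u < n \<and> idx u = cnt A u"
        using v' cnt_eqv[OF True, of A] by (auto simp: cls_def)
      then show ?thesis using True v' assms
        by (auto simp: canon_def cnt_insert less_Suc_eq cls_def)
    next
      case False
      then have "u \<noteq> v'" using v' eqv_sym by (auto simp: cls_def)
      then show ?thesis using False assms by (simp add: canon_def cnt_insert)
    qed
  qed
  moreover have "v' \<notin> canon A"
    using v' cnt_eqv[of v' v A] by (auto simp: canon_def cls_def)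
  ultimately show thesis using that v' eqv_sym by (auto simp: cls_def)
qed

section \<open>Sets with the same number of vertices in each class\<close>

text \<open>A transposition of twins sends every vertex to an equivalent one, so
  \<open>eqv_edge\<close> preserves edges; the converse holds because it is an involution.\<close>

lemma transpose_auto:
  assumes "eqv u v" "u < n" "v < n"
  shows "graph_auto V E (transpose u v)"
proof
  show "sgraph V E" by (rule graph)
  show "bij (transpose u v)" by simp
  show "transpose u v ` V = V"
    using assms by (simp add: transpose_image_eq)
  have eqv: "eqv x (transpose u v x)" for x
    using assms(1) eqv_sym by (simp add: transpose_def)
  have edge: "E (transpose u v x) (transpose u v y)" if "E x y" for x y
  proof (rule eqv_edge[OF that eqv eqv])
    show "transpose u v x \<noteq> transpose u v y"
      using that E_irrefl by (metis transpose_eq_iff)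
  qed
  show "E (transpose u v x) (transpose u v y) = E x y" for x y
    using edge[of x y] edge[of "transpose u v x" "transpose u v y"] by auto
qed

text \<open>Equal counts give every \<open>u\<close> in \<open>A - B\<close> a class mate
  \<open>v\<close> in \<open>B - A\<close>; exchanging the two keeps all counts and shrinks
  \<open>A - B\<close>. If \<open>A - B\<close> is empty, equal counts force \<open>A = B\<close>.
  Invariance under single twin exchanges thus suffices.\<close>

lemma swap_induct:
  assumes "A \<subseteq> V" "B \<subseteq> V" "\<And>v. cnt A v = cnt B v" "P A"
    and swap: "\<And>A u v. A \<subseteq> V \<Longrightarrow> P A \<Longrightarrow> u \<in> A \<Longrightarrow> v < n \<Longrightarrow> v \<notin> A \<Longrightarrow> eqv u v \<Longrightarrow> P (insert v (A - {u}))"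
  shows "P B"
  using assms(1-4)
proof (induction "card (A - B)" arbitrary: A)
  case 0
  have fin: "finite A" "finite B" using 0 finite_subset[OF _ finite_lessThan] by blast+
  with 0 have "A \<subseteq> B" by simp
  moreover have "b \<in> A" if "b \<in> B" for b
  proof (rule ccontr)
    assume "b \<notin> A"
    moreover have "b \<in> cls b" using that 0 by (intro cls_self) auto
    ultimately have "A \<inter> cls b \<subset> B \<inter> cls b" using that \<open>A \<subseteq> B\<close> by blast
    then have "cnt A b < cnt B b" unfolding cnt_def by (intro psubset_card_mono) simp_all
    with 0 show False by simp
  qed
  ultimately have "A = B" by blast
  with 0 show ?case by simp
next
  case (Suc m)
  have fin: "finite A" "finite B" using Suc finite_subset[OF _ finite_lessThan] by blast+
  have "A - B \<noteq> {}" using Suc.hyps(2) by (metis card.empty Zero_not_Suc)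
  then obtain u where u: "u \<in> A" "u \<notin> B" by blast
  have "\<exists>v \<in> B \<inter> cls u. v \<notin> A"
  proof (rule ccontr)
    assume "\<not> ?thesis"
    moreover have "u \<in> cls u" using u Suc.prems by (intro cls_self) auto
    ultimately have "B \<inter> cls u \<subset> A \<inter> cls u" using u by blast
    then have "cnt B u < cnt A u" unfolding cnt_def by (intro psubset_card_mono) simp_all
    with Suc.prems show False by simp
  qed
  then obtain v where v: "v \<in> B" "v \<notin> A" "eqv u v" "v < n"
    using eqv_sym by (auto simp: cls_def)
  have "u < n" using u Suc.prems by auto
  let ?A = "insert v (A - {u})"
  have "cnt ?A w = cnt B w" for w
  proof -
    have "cnt ?A w = cnt (A - {u}) w + of_bool (eqv v w)" using v by (intro cnt_insert) auto
    also have "eqv v w \<longleftrightarrow> eqv u w" using v eqv_sym eqv_trans by blast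
    also have "cnt (A - {u}) w + of_bool (eqv u w) = cnt (insert u (A - {u})) w"
      using \<open>u < n\<close> by (intro cnt_insert[symmetric]) auto
    also have "insert u (A - {u}) = A" using u by blast
    finally show ?thesis using Suc.prems by simp
  qed
  moreover have "m = card (?A - B)"
  proof -
    have "?A - B = (A - B) - {u}" using v by auto
    then show ?thesis using Suc.hyps(2) fin u by simp
  qed
  moreover have "?A \<subseteq> V" "P ?A" using swap Suc.prems u v by auto
  ultimately show ?case using Suc.hyps(1) Suc.prems(2) by blast
qed

lemma canon_subset: "canon A \<subseteq> V"
  by (auto simp: canon_def)

lemma card_canon:
  assumes "A \<subseteq> V"
  shows "card (canon A) = card A"
proof (rule swap_induct[where A = A and P = "\<lambda>B. card B = card A"])
  fix B :: "nat set" and u v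
  assume B: "B \<subseteq> V" "u \<in> B" "v \<notin> B" "card B = card A"
  then have "finite B" using finite_subset by blast
  with B have "card (insert v (B - {u})) = Suc (card (B - {u}))" by (intro card_insert_disjoint) auto
  also have "\<dots> = card B" using \<open>finite B\<close> B by (intro card.remove[symmetric])
  finally show "card (insert v (B - {u})) = card A" using B by simp
qed (simp_all add: assms canon_subset cnt_canon)

lemma has_prop_canon:
  assumes "has_prop Z V E A"
  shows "has_prop Z V E (canon A)"
proof (rule swap_induct[where A = A and P = "has_prop Z V E"])
  fix B :: "nat set" and u v
  assume *: "B \<subseteq> V" "u \<in> B" "v < n" "v \<notin> B" "has_prop Z V E B" "eqv u v"
  interpret graph_auto V E "transpose u v"
    by (rule transpose_auto) (use * in auto)
  have "transpose u v ` B = insert v (B - {u})"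
    using * by (auto simp: transpose_def image_iff split: if_splits)
  then show "has_prop Z V E (insert v (B - {u}))"
    using has_prop_image[OF \<open>has_prop Z V E B\<close>] by simp
next
  show "A \<subseteq> V" using assms by (cases Z) auto
qed (simp_all add: assms canon_subset cnt_canon)

end

context reconf_graph
begin

section \<open>Size of the state space, and formulas for sets and steps\<close>

section \<open>The number of active vertices\<close>

lemma eqv_nd_rel: "u < n \<Longrightarrow> v < n \<Longrightarrow>
    eqv u v \<longleftrightarrow> (u, v) \<in> nd_rel V E \<and> (s u \<longleftrightarrow> s v) \<and> (t u \<longleftrightarrow> t v)"
  unfolding eqv_def nd_rel_def nbrs_def using E_less by (auto simp: set_eq_iff)

text \<open>An active vertex is determined by its neighborhood class, its membership in
  \<open>s\<close> and in \<open>t\<close>, the end of its refined class that it is near to, and its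
  distance below \<open>k\<close> from that end.\<close>

lemma dim_le: "dim \<le> 8 * nd V E * k"
proof -
  let ?r = "nd_rel V E"
  let ?A = "{u. u < n \<and> active u}"
  \<comment> \<open>The flag \<open>idx v < k\<close> selects the end;
    \<open>csize v - Suc (idx v)\<close> counts the vertices after \<open>v\<close>, so the last
    vertex has distance 0.\<close>
  let ?g = "\<lambda>v. (?r `` {v}, s v, t v, idx v < k, if idx v < k then idx v else csize v - Suc (idx v))"
  let ?B = "(V // ?r) \<times> (UNIV :: bool set) \<times> (UNIV :: bool set) \<times> (UNIV :: bool set) \<times> {..<k}"
  have "inj_on ?g ?A"
  proof (rule inj_onI)
    fix u v assume u: "u \<in> ?A" and v: "v \<in> ?A" and eq: "?g u = ?g v"
    then have "u < n" "v < n" by auto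
    have "(v, v) \<in> ?r" using \<open>v < n\<close> by (simp add: nd_rel_def)
    then have "v \<in> ?r `` {u}" using eq by auto
    then have "eqv u v" using eq \<open>u < n\<close> \<open>v < n\<close> by (simp add: eqv_nd_rel)
    then have c: "cls u = cls v" by (rule cls_eq)
    then have "csize u = csize v" by (simp add: csize_cls)
    moreover have "idx u < csize u" "idx v < csize v" using idx_less \<open>u < n\<close> \<open>v < n\<close> by auto
    ultimately have "idx u = idx v" using eq by (auto split: if_splits)
    then show "u = v"
      using inj_onD[OF idx_inj[of v], of u v] cls_self[OF \<open>u < n\<close>] cls_self[OF \<open>v < n\<close>] c by auto
  qed
  moreover have "?g ` ?A \<subseteq> ?B"
  proof (rule image_subsetI)
    fix v assume "v \<in> ?A"
    then have "v < n" "active v" by auto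
    then have "csize v - Suc (idx v) < k" if "\<not> idx v < k"
      using that idx_less[of v] unfolding active_def by linarith
    then show "?g v \<in> ?B" using \<open>v < n\<close> by (simp add: quotientI)
  qed
  moreover have fin: "finite (V // ?r)"
    unfolding quotient_def by simp
  then have "finite ?B" by simp
  ultimately have "card ?A \<le> card ?B" by (rule card_inj_on_le)
  also have "card ?B = 8 * nd V E * k"
    by (simp add: card_cartesian_product nd_def card_UNIV_bool)
  finally show ?thesis by (simp add: dim_def)
qed

section \<open>Bounded formulas and the properties they express\<close>

abbreviation set_of :: "(nat \<Rightarrow> bool) \<Rightarrow> nat set" where
  "set_of a \<equiv> {v. v < n \<and> a v}"

lemma finite_V_subset: "A \<subseteq> V \<Longrightarrow> finite A"
  using finite_subset by blast

lemma deg_in_set_of: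
  "deg_in E (set_of a) v = card {u. u < n \<and> E u v \<and> a u}"
  "deg_in E (V - set_of a) v = card {u. u < n \<and> E u v \<and> \<not> a u}"
  unfolding deg_in_def nbrs_def using E_sym by (auto intro!: arg_cong[of _ _ card])

lemma defensive_set_of: "defensive V E (set_of a) \<longleftrightarrow> def_fm n E a"
  by (auto simp: defensive_def def_fm_def deg_in_set_of)

lemma boundary_set_of: "v \<in> boundary E (set_of a) \<longleftrightarrow> v < n \<and> \<not> a v \<and> (\<exists>u<n. a u \<and> E u v)"
  unfolding boundary_def closed_nbrs_def nbrs_def using E_less by auto

lemma offensive_set_of: "offensive V E (set_of a) \<longleftrightarrow> off_fm n E a"
  by (auto simp: offensive_def off_fm_def deg_in_set_of boundary_set_of Suc_le_eq)

lemma dominating_set_of: "dominating V E (set_of a) \<longleftrightarrow> dom_fm n E a"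
  unfolding dominating_def dom_fm_def closed_nbrs_def nbrs_def using E_less
  by (auto simp: set_eq_iff)

lemma independent_set_of: "independent E (set_of a) \<longleftrightarrow> indep_fm n E a"
  by (auto simp: independent_def indep_fm_def)

definition admissible :: "alliance \<Rightarrow> token_model \<Rightarrow> nat \<Rightarrow> nat set \<Rightarrow> bool" where
  "admissible Z TM h A \<longleftrightarrow> has_prop Z V E A \<and> (TM = TAR \<longrightarrow> card A \<le> h)"

lemma admissible_subset: "admissible Z TM h A \<Longrightarrow> A \<subseteq> V"
  by (cases Z) (auto simp: admissible_def)

lemma admissible_set_of: "admissible Z TM h (set_of a) \<longleftrightarrow> valid_fm Z TM n E h a"
proof -
  have "set_of a \<subseteq> V" by auto
  then show ?thesis
    by (cases Z) (simp_all add: admissible_def valid_fm_def defensive_set_of offensive_set_of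
      dominating_set_of independent_set_of)
qed

lemma tstep_TJ_iff:
  assumes "finite A" "finite B"
  shows "card A = card B \<and> card (A - B) = 1 \<longleftrightarrow> card (A - B) = 1 \<and> card (B - A) = 1"
proof -
  have "card A = card (A - B) + card (A \<inter> B)" "card B = card (B - A) + card (A \<inter> B)"
    using card_Diff_subset_Int[of A B] card_Diff_subset_Int[of B A] assms
      card_mono[of A "A \<inter> B"] card_mono[of B "A \<inter> B"] by (simp_all add: Int_commute)
  then show ?thesis by auto
qed

text \<open>Describes all three models by the sizes of the two differences, which is the form that
  \<open>step_fm\<close> evaluates; a sum of 1 means one empty difference and one singleton.\<close>

lemma tstep_iff:
  assumes "finite A" "finite B"
  shows "tstep TM E A B \<longleftrightarrow>
    (if TM = TAR then card (A - B) + card (B - A) = 1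
     else card (A - B) = 1 \<and> card (B - A) = 1 \<and> (TM = TS \<longrightarrow> (\<exists>u\<in>A - B. \<exists>v\<in>B - A. E u v)))"
proof (cases TM)
  case TJ
  then show ?thesis using tstep_TJ_iff[OF assms] by simp
next
  case TS
  have "(\<exists>u v. A - B = {u} \<and> B - A = {v} \<and> E u v) \<longleftrightarrow> (\<exists>u\<in>A - B. \<exists>v\<in>B - A. E u v)"
    if "card (A - B) = 1" "card (B - A) = 1"
  proof -
    from that(1) obtain u where "A - B = {u}" by (rule card_1_singletonE)
    moreover from that(2) obtain v where "B - A = {v}" by (rule card_1_singletonE)
    ultimately have "A - B = {u}" "B - A = {v}" .
    then show ?thesis by auto
  qed
  then have "card A = card B \<and> card (A - B) = 1 \<and> (\<exists>u v. A - B = {u} \<and> B - A = {v} \<and> E u v) \<longleftrightarrow>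
      card (A - B) = 1 \<and> card (B - A) = 1 \<and> (\<exists>u\<in>A - B. \<exists>v\<in>B - A. E u v)"
    using tstep_TJ_iff[OF assms] by argo
  with TS show ?thesis by simp
next
  case TAR
  have ins: "(\<exists>v. v \<notin> A \<and> B = insert v A) \<longleftrightarrow> card (A - B) = 0 \<and> card (B - A) = 1" if "finite A" for A B :: "nat set"
  proof
    assume "card (A - B) = 0 \<and> card (B - A) = 1"
    moreover from this have "card (B - A) = 1" by blast
    then obtain v where "B - A = {v}" by (rule card_1_singletonE)
    ultimately have "v \<notin> A" "B = insert v A" using that by auto
    then show "\<exists>v. v \<notin> A \<and> B = insert v A" by blast
  next
    assume "\<exists>v. v \<notin> A \<and> B = insert v A"
    then obtain v where "v \<notin> A" "B = insert v A" by blast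
    then have "A - B = {}" "B - A = {v}" by auto
    then show "card (A - B) = 0 \<and> card (B - A) = 1" by (simp only: card.empty) simp
  qed
  show ?thesis
    unfolding TAR tstep.simps ins[OF assms(1)] ins[OF assms(2)] by (simp only: if_True refl) arith
qed

lemma tstep_set_of: "tstep TM E (set_of a) (set_of b) \<longleftrightarrow> step_fm TM n E a b"
proof -
  have "set_of a - set_of b = {v. v < n \<and> a v \<and> \<not> b v}" "set_of b - set_of a = {v. v < n \<and> b v \<and> \<not> a v}"
    by auto
  then show ?thesis
    by (auto simp: tstep_iff step_fm_def)
qed

section \<open>Replacing a sequence by frozen canonical sets\<close>

section \<open>Canonical reconfiguration sequences\<close>

definition move :: "alliance \<Rightarrow> token_model \<Rightarrow> nat \<Rightarrow> (nat set \<times> nat set) set" where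
  "move Z TM h = {(A, B). admissible Z TM h B \<and> tstep TM E A B}"

text \<open>The sets that can be coded by the bits of their active vertices, see
  \<open>frozen_mem\<close> and \<open>frozen_code\<close>.\<close>

definition frozen :: "nat set \<Rightarrow> bool" where
  "frozen A \<longleftrightarrow> A \<subseteq> V \<and> (\<forall>v<n. \<not> active v \<longrightarrow> (v \<in> A \<longleftrightarrow> s v))"

definition frozen_move :: "alliance \<Rightarrow> token_model \<Rightarrow> nat \<Rightarrow> (nat set \<times> nat set) set" where
  "frozen_move Z TM h = {(A, B). frozen A \<and> frozen B \<and> (A, B) \<in> move Z TM h}"

lemma reconf_seq_relpow:
  "(\<exists>xs. reconf_seq Z TM V E h A B xs \<and> length xs = Suc j) \<longleftrightarrow>
    admissible Z TM h A \<and> (A, B) \<in> move Z TM h ^^ j"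
proof (induction j arbitrary: B)
  case 0
  have "reconf_seq Z TM V E h A A [A]" if "admissible Z TM h A"
    using that by (simp add: reconf_seq_def admissible_def)
  moreover have "admissible Z TM h A \<and> A = B" if "reconf_seq Z TM V E h A B xs" "length xs = Suc 0" for xs
    using that by (auto simp: reconf_seq_def admissible_def length_Suc_conv)
  ultimately show ?case by (auto intro: exI[of _ "[A]"])
next
  case (Suc j)
  have "(\<exists>xs. reconf_seq Z TM V E h A B xs \<and> length xs = Suc (Suc j)) \<longleftrightarrow>
    (\<exists>C. (\<exists>xs. reconf_seq Z TM V E h A C xs \<and> length xs = Suc j) \<and> (C, B) \<in> move Z TM h)"
  proof safe
    fix xs assume xs: "reconf_seq Z TM V E h A B xs" "length xs = Suc (Suc j)"
    then obtain ys where ys: "xs = ys @ [B]" "length ys = Suc j"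
      by (cases xs rule: rev_cases) (auto simp: reconf_seq_def)
    then have "ys \<noteq> []" by auto
    then have "reconf_seq Z TM V E h A (last ys) ys" "(last ys, B) \<in> move Z TM h"
      using xs ys by (auto simp: reconf_seq_def move_def admissible_def successively_append_iff)
    then show "\<exists>C. (\<exists>xs. reconf_seq Z TM V E h A C xs \<and> length xs = Suc j) \<and> (C, B) \<in> move Z TM h"
      using ys by blast
  next
    fix C ys assume "reconf_seq Z TM V E h A C ys" "length ys = Suc j" "(C, B) \<in> move Z TM h"
    then have "reconf_seq Z TM V E h A B (ys @ [B])" "length (ys @ [B]) = Suc (Suc j)"
      by (auto simp: reconf_seq_def move_def admissible_def successively_append_iff)
    then show "\<exists>xs. reconf_seq Z TM V E h A B xs \<and> length xs = Suc (Suc j)" by blast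
  qed
  also have "\<dots> \<longleftrightarrow> admissible Z TM h A \<and> (A, B) \<in> move Z TM h ^^ Suc j"
    by (auto simp: Suc.IH relcomp_unfold)
  finally show ?case .
qed

text \<open>Presents every step by insertions into a common set, so that \<open>canon_insert\<close>
  applies to both ends.\<close>

lemma tstep_cases:
  assumes "A \<subseteq> V" "B \<subseteq> V" "tstep TM E A B"
  obtains (add) v where "TM = TAR" "v \<notin> A" "v < n" "B = insert v A"
  | (del) v where "TM = TAR" "v \<notin> B" "v < n" "A = insert v B"
  | (exchange) u v D where "TM \<noteq> TAR" "u < n" "v < n" "u \<notin> D" "v \<notin> D" "A = insert u D" "B = insert v D"
      "u \<noteq> v" "TM = TS \<longrightarrow> E u v"
proof (cases "TM = TAR")
  case True
  with assms show thesis using add del by fastforce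
next
  case False
  have "finite A" "finite B" using assms finite_V_subset by auto
  from assms(3)[unfolded tstep_iff[OF this]] False
  have *: "card (A - B) = 1" "card (B - A) = 1" "TM = TS \<longrightarrow> (\<exists>u\<in>A - B. \<exists>v\<in>B - A. E u v)" by auto
  from *(1) obtain u where u: "A - B = {u}" by (rule card_1_singletonE)
  from *(2) obtain v where v: "B - A = {v}" by (rule card_1_singletonE)
  note uv = u v
  have "u \<in> A - B" "v \<in> B - A" using uv by auto
  then have "u \<noteq> v" "u \<notin> A \<inter> B" "v \<notin> A \<inter> B" "u < n" "v < n" using assms by auto
  moreover have "A = insert u (A \<inter> B)" "B = insert v (A \<inter> B)" using uv by blast+
  moreover have "TM = TS \<longrightarrow> E u v" using * uv by auto
  ultimately show thesis using False by - (rule exchange[of u v "A \<inter> B"])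
qed

text \<open>In an exchange, both canonical sets extend \<open>canon D\<close> by one vertex,
  equivalent to \<open>u\<close> and to \<open>v\<close> respectively. If these vertices coincide,
  the step vanishes; otherwise it is an exchange again, and for sliding \<open>eqv_edge\<close>
  carries over the edge.\<close>

lemma canon_step:
  assumes "A \<subseteq> V" "B \<subseteq> V" "tstep TM E A B"
  shows "canon A = canon B \<or> tstep TM E (canon A) (canon B)"
  using assms
proof (cases rule: tstep_cases)
  case (add v)
  then show ?thesis using canon_insert[of v A] by (metis tstep.simps(3))
next
  case (del v)
  then show ?thesis using canon_insert[of v B] by (metis tstep.simps(3))
next
  case (exchange u v D)
  obtain u' where u': "eqv u u'" "u' \<notin> canon D" "canon A = insert u' (canon D)"
    using canon_insert[of u D] exchange by metis
  obtain v' where v': "eqv v v'" "v' \<notin> canon D" "canon B = insert v' (canon D)"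
    using canon_insert[of v D] exchange by metis
  show ?thesis
  proof (cases "u' = v'")
    case False
    then have "canon A - canon B = {u'}" "canon B - canon A = {v'}" using u' v' by auto
    moreover have "TM = TS \<longrightarrow> E u' v'" using exchange u' v' False eqv_edge by blast
    ultimately have "tstep TM E (canon A) (canon B)"
      using exchange finite_V_subset[OF canon_subset] by (simp add: tstep_iff)
    then show ?thesis ..
  qed (use u' v' in simp)
qed

lemma cnt_step:
  assumes "A \<subseteq> V" "B \<subseteq> V" "tstep TM E A B"
  shows "cnt B w \<le> Suc (cnt A w) \<and> cnt A w \<le> Suc (cnt B w)"
  using assms by (cases rule: tstep_cases) (auto simp: cnt_insert)

lemma admissible_canon: "admissible Z TM h A \<Longrightarrow> admissible Z TM h (canon A)"
  using admissible_subset[of Z TM h A] by (simp add: admissible_def has_prop_canon card_canon)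

text \<open>Inactive vertices are too far from both ends of their class to be reached by canonical sets.\<close>

lemma frozen_canon_near:
  assumes "j < k" "\<And>v. v < n \<Longrightarrow> cnt A v \<le> cnt (set_of s) v + j \<and> cnt (set_of s) v \<le> cnt A v + j"
  shows "frozen (canon A)"
  unfolding frozen_def
proof (intro conjI canon_subset allI impI)
  fix v assume v: "v < n" "\<not> active v"
  have "v \<in> set_of s \<longleftrightarrow> idx v < cnt (set_of s) v" using canon_src v(1) by (auto simp: canon_def)
  \<comment> \<open>The count of \<open>A\<close> is therefore within \<open>j < k\<close> of 0 or
    of the class size, while an inactive index is at distance at least \<open>k\<close> from
    both.\<close>
  moreover have "cnt (set_of s) v = 0 \<or> cnt (set_of s) v = csize v"
  proof -
    have "set_of s \<inter> cls v = (if s v then cls v else {})" by (auto simp: cls_def eqv_iff)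
    then show ?thesis by (auto simp: cnt_def csize_cls)
  qed
  ultimately show "v \<in> canon A \<longleftrightarrow> s v"
    using assms(1) assms(2)[OF v(1)] v idx_less[OF v(1)] unfolding canon_def active_def by auto
qed

text \<open>Segments of canonical sets have length at most \<open>k\<close>, and an inactive vertex
  has index at least \<open>k\<close>; so neither \<open>canon A\<close> nor the start set contains
  it.\<close>

lemma frozen_canon_small:
  assumes "A \<subseteq> V" "card A \<le> k" "card (set_of s) \<le> k"
  shows "frozen (canon A)"
  unfolding frozen_def
proof (intro conjI canon_subset allI impI)
  fix v assume v: "v < n" "\<not> active v"
  have "cnt B v \<le> card B" if "B \<subseteq> V" for B
    unfolding cnt_def using that finite_V_subset by (intro card_mono) auto
  from this[of A] this[of "set_of s"] have "cnt A v \<le> k" "cnt (set_of s) v \<le> k"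
    using assms by fastforce+
  moreover have "s v \<longleftrightarrow> idx v < cnt (set_of s) v" using canon_src v(1) by (auto simp: canon_def)
  ultimately show "v \<in> canon A \<longleftrightarrow> s v"
    using v by (auto simp: canon_def active_def)
qed

text \<open>The alternatives in the last premise are the two parameters. A move changes a class
  count by at most one, which settles \<open>j < k\<close>; otherwise the size stays bounded by
  \<open>k\<close>, being constant under exchanges and limited by the threshold \<open>h\<close>
  under addition and removal.\<close>

lemma frozen_canon_path:
  assumes "(set_of s, A) \<in> move Z TM h ^^ i" "admissible Z TM h (set_of s)" "i \<le> j"
    and "j < k \<or> card (set_of s) \<le> k \<and> (TM = TAR \<longrightarrow> h \<le> k)"
  shows "frozen (canon A) \<and> admissible Z TM h A"
proof -
  have "admissible Z TM h A \<and> (TM \<noteq> TAR \<longrightarrow> card A = card (set_of s)) \<and>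
      (\<forall>v<n. cnt A v \<le> cnt (set_of s) v + i \<and> cnt (set_of s) v \<le> cnt A v + i)"
    using assms(1)
  proof (induction i arbitrary: A)
    case 0
    then show ?case using assms(2) by simp
  next
    case (Suc i)
    then obtain C where C: "(set_of s, C) \<in> move Z TM h ^^ i" "(C, A) \<in> move Z TM h" by auto
    have A: "admissible Z TM h A" and st: "tstep TM E C A" using C(2) by (auto simp: move_def)
    note IH = Suc.IH[OF C(1)]
    have "TM \<noteq> TAR \<longrightarrow> card A = card C" using st by (cases TM) auto
    moreover have "cnt A v \<le> cnt (set_of s) v + Suc i \<and> cnt (set_of s) v \<le> cnt A v + Suc i"
      if "v < n" for v
    proof -
      have "A \<subseteq> V" "C \<subseteq> V"
        using A IH admissible_subset[of Z TM h A] admissible_subset[of Z TM h C] by auto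
      then have "cnt A v \<le> Suc (cnt C v) \<and> cnt C v \<le> Suc (cnt A v)"
        using cnt_step[OF _ _ st] by simp
      then show ?thesis using IH that by (elim conjE allE[of _ v]) linarith
    qed
    ultimately show ?case using A IH by simp
  qed
  then show ?thesis
    using assms(3,4) frozen_canon_near[of i A] frozen_canon_small[of A] admissible_subset[of Z TM h A]
    by (cases "j < k") (auto simp: admissible_def)
qed

text \<open>Vanishing steps only shorten the path; the timed version needs
  \<open>l \<le> i\<close>.\<close>

lemma canon_path:
  assumes "(set_of s, A) \<in> move Z TM h ^^ i" "admissible Z TM h (set_of s)" "i \<le> j"
    and "j < k \<or> card (set_of s) \<le> k \<and> (TM = TAR \<longrightarrow> h \<le> k)"
  shows "\<exists>l\<le>i. (set_of s, canon A) \<in> frozen_move Z TM h ^^ l"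
  using assms(1,3)
proof (induction i arbitrary: A)
  case 0
  then have "A = set_of s" by simp
  then show ?case by (simp add: canon_src)
next
  case (Suc i)
  then obtain C where C: "(set_of s, C) \<in> move Z TM h ^^ i" "(C, A) \<in> move Z TM h" by auto
  have fr: "frozen (canon A)" "frozen (canon C)" "admissible Z TM h A" "admissible Z TM h C"
    using frozen_canon_path[OF Suc.prems(1) assms(2) Suc.prems(2) assms(4)]
      frozen_canon_path[OF C(1) assms(2) _ assms(4)] Suc.prems by auto
  obtain l where l: "l \<le> i" "(set_of s, canon C) \<in> frozen_move Z TM h ^^ l"
    using Suc.IH[OF C(1)] Suc.prems by auto
  have "canon C = canon A \<or> tstep TM E (canon C) (canon A)"
    using C fr by (intro canon_step admissible_subset) (auto simp: move_def)
  then show ?case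
  proof
    assume "canon C = canon A"
    then show ?thesis using l by (metis le_SucI)
  next
    assume "tstep TM E (canon C) (canon A)"
    then have "(canon C, canon A) \<in> frozen_move Z TM h"
      using fr admissible_canon by (simp add: frozen_move_def move_def)
    then have "(set_of s, canon A) \<in> frozen_move Z TM h ^^ Suc l" using l by auto
    then show ?thesis using l by (metis Suc_le_mono)
  qed
qed

end

section \<open>Search on codes against reconfiguration sequences\<close>

section \<open>Correctness of the search\<close>

lemma odd_div_sum_pow2:
  "odd ((\<Sum>j<m. if P j then 2 ^ j else 0 :: nat) div 2 ^ i) \<longleftrightarrow> i < m \<and> P i"
proof -
  have "(\<Sum>j<m. if P j then 2 ^ j else 0 :: nat) = horner_sum of_bool 2 (map P [0..<m])"
    unfolding horner_sum_eq_sum lessThan_atLeast0 by (rule sum.cong) auto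
  then show ?thesis
    by (auto simp: bit_iff_odd[symmetric] bit_horner_sum_bit_iff)
qed

lemma elt_code_set: "S < N \<Longrightarrow> elt N (code_set N P) S \<longleftrightarrow> P S"
proof -
  have "code_set N P = (\<Sum>S<N. if P S then 2 ^ S else 0)"
    unfolding code_set_def by (rule sum.cong) auto
  then show "S < N \<Longrightarrow> ?thesis" by (simp add: elt_def odd_div_sum_pow2)
qed

lemma exists_bits:
  obtains S :: nat where "S < 2 ^ m" "\<And>i. i < m \<Longrightarrow> odd (S div 2 ^ i) \<longleftrightarrow> P i"
proof
  let ?S = "\<Sum>j<m. if P j then 2 ^ j else 0 :: nat"
  have "?S \<le> (\<Sum>j<m. 2 ^ j)" by (rule sum_mono) simp
  also have "(\<Sum>j<m. 2 ^ j) < (2 ^ m :: nat)" by (induction m) auto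
  finally show "?S < 2 ^ m" .
  show "odd (?S div 2 ^ i) \<longleftrightarrow> P i" if "i < m" for i
    using that by (simp add: odd_div_sum_pow2)
qed

lemma elt_reach_code:
  assumes "S < N"
  shows "elt N (reach_code N I Q r) S \<longleftrightarrow>
    (\<exists>j\<le>r. \<exists>a<N. I a \<and> (a, S) \<in> {(a, b). a < N \<and> b < N \<and> Q a b} ^^ j)"
  using assms
proof (induction r arbitrary: S)
  case 0
  then show ?case by (auto simp: reach_code_def elt_code_set)
next
  case (Suc r)
  let ?R = "{(a, b). a < N \<and> b < N \<and> Q a b}"
  have "elt N (reach_code N I Q (Suc r)) S \<longleftrightarrow>
      elt N (reach_code N I Q r) S \<or> (\<exists>S'<N. elt N (reach_code N I Q r) S' \<and> Q S' S)"
    using Suc.prems by (simp add: reach_code_def elt_code_set)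
  also have "\<dots> \<longleftrightarrow> (\<exists>j\<le>r. \<exists>a<N. I a \<and> (a, S) \<in> ?R ^^ j) \<or>
      (\<exists>j\<le>r. \<exists>a<N. I a \<and> (a, S) \<in> ?R ^^ Suc j)"
  proof -
    have "(\<exists>S'<N. elt N (reach_code N I Q r) S' \<and> Q S' S) \<longleftrightarrow>
        (\<exists>S'. (\<exists>j\<le>r. \<exists>a<N. I a \<and> (a, S') \<in> ?R ^^ j) \<and> (S', S) \<in> ?R)"
      using Suc.IH Suc.prems by auto
    also have "\<dots> \<longleftrightarrow> (\<exists>j\<le>r. \<exists>a<N. I a \<and> (a, S) \<in> ?R ^^ Suc j)"
      by (auto simp: relcomp_unfold)
    finally show ?thesis using Suc.IH[OF Suc.prems] by simp
  qed
  also have "\<dots> \<longleftrightarrow> (\<exists>j\<le>Suc r. \<exists>a<N. I a \<and> (a, S) \<in> ?R ^^ j)"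
  proof
    assume "\<exists>j\<le>Suc r. \<exists>a<N. I a \<and> (a, S) \<in> ?R ^^ j"
    then obtain j a where j: "j \<le> Suc r" "a < N" "I a" "(a, S) \<in> ?R ^^ j" by blast
    show "(\<exists>j\<le>r. \<exists>a<N. I a \<and> (a, S) \<in> ?R ^^ j) \<or> (\<exists>j\<le>r. \<exists>a<N. I a \<and> (a, S) \<in> ?R ^^ Suc j)"
    proof (cases j)
      case 0
      then show ?thesis using j by blast
    next
      case (Suc i)
      then show ?thesis using j by blast
    qed
  next
    assume "(\<exists>j\<le>r. \<exists>a<N. I a \<and> (a, S) \<in> ?R ^^ j) \<or> (\<exists>j\<le>r. \<exists>a<N. I a \<and> (a, S) \<in> ?R ^^ Suc j)"
    then show "\<exists>j\<le>Suc r. \<exists>a<N. I a \<and> (a, S) \<in> ?R ^^ j"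
      by (meson Suc_le_mono le_SucI)
  qed
  finally show ?case .
qed

text \<open>Any walk can be cut down to at most \<open>card R\<close> steps, and \<open>R\<close>
  has at most \<open>N * N\<close> pairs; this is the origin of the cap on the rounds.\<close>

lemma relpow_bounded_below:
  assumes "(a, b) \<in> R ^^ j" "R \<subseteq> {..<N} \<times> {..<N::nat}"
  shows "\<exists>i\<le>min j (N * N). (a, b) \<in> R ^^ i"
proof (cases "j \<le> N * N")
  case True
  then show ?thesis using assms by auto
next
  case False
  have "finite R" using assms(2) finite_subset by blast
  then obtain i where "i \<le> card R" "(a, b) \<in> R ^^ i"
    using relpow_finite_bounded[of R j] assms(1) by blast
  moreover have "card R \<le> N * N"
    using card_mono[OF _ assms(2)] by (simp add: card_cartesian_product)
  ultimately show ?thesis using False by (intro exI[of _ i]) auto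
qed

context reconf_graph
begin

lemma frozen_mem: "frozen (set_of (mem S))"
  by (auto simp: frozen_def mem_def)

text \<open>\<open>rank\<close> is a bijection from the active vertices onto the bit positions below
  \<open>dim\<close>, so the bits can be prescribed vertex by vertex.\<close>

lemma frozen_code:
  assumes "frozen A"
  obtains S where "S < 2 ^ dim" "set_of (mem S) = A"
proof -
  let ?T = "{u. u < n \<and> active u}"
  have rank: "rank v = card {u \<in> ?T. u < v}" for v
    unfolding rank_def by (rule arg_cong[of _ _ card]) auto
  have inj: "inj_on rank ?T" and img: "rank ` ?T = {..<dim}"
    using inj_on_rank[of ?T] rank_image[of ?T] by (simp_all add: rank[abs_def] dim_def)
  obtain S :: nat where S: "S < 2 ^ dim" "\<And>i. i < dim \<Longrightarrow> odd (S div 2 ^ i) \<longleftrightarrow> (\<exists>v\<in>?T. rank v = i \<and> v \<in> A)"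
    by (rule exists_bits[of dim "\<lambda>i. \<exists>v\<in>?T. rank v = i \<and> v \<in> A"]) blast
  have "mem S v \<longleftrightarrow> v \<in> A" if "v < n" for v
  proof (cases "active v")
    case True
    then have v: "v \<in> ?T" using that by simp
    then have "odd (S div 2 ^ rank v) \<longleftrightarrow> (\<exists>u\<in>?T. rank u = rank v \<and> u \<in> A)"
      using S(2)[of "rank v"] img by blast
    also have "\<dots> \<longleftrightarrow> v \<in> A" using v inj_onD[OF inj] by blast
    finally show ?thesis using True by (simp add: mem_def)
  next
    case False
    then show ?thesis using assms that by (simp add: mem_def frozen_def)
  qed
  then have "set_of (mem S) = A" using assms by (auto simp: frozen_def)
  with S(1) show thesis by (rule that)
qed

text \<open>\<open>R\<close> is the preimage of \<open>frozen_move\<close> under decoding, and every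
  frozen set has a code; hence paths project to frozen sets and lift to codes from any given
  starting code.\<close>

lemma frozen_relpow_codes:
  defines "R \<equiv> \<lambda>Z TM h. {(a, b). a < 2 ^ dim \<and> b < 2 ^ dim \<and>
     valid_fm Z TM n E h (mem b) \<and> step_fm TM n E (mem a) (mem b)}"
  shows "(a, b) \<in> R Z TM h ^^ j \<Longrightarrow> (set_of (mem a), set_of (mem b)) \<in> frozen_move Z TM h ^^ j"
    and "(A, B) \<in> frozen_move Z TM h ^^ j \<Longrightarrow> a < 2 ^ dim \<Longrightarrow> set_of (mem a) = A \<Longrightarrow>
      \<exists>b<2 ^ dim. set_of (mem b) = B \<and> (a, b) \<in> R Z TM h ^^ j"
proof -
  have R_iff: "(a, b) \<in> R Z TM h \<longleftrightarrow> a < 2 ^ dim \<and> b < 2 ^ dim \<and>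
      (set_of (mem a), set_of (mem b)) \<in> frozen_move Z TM h" for a b
    by (simp add: R_def frozen_move_def frozen_mem move_def admissible_set_of tstep_set_of)
  show "(set_of (mem a), set_of (mem b)) \<in> frozen_move Z TM h ^^ j" if "(a, b) \<in> R Z TM h ^^ j"
    using that
  proof (induction j arbitrary: b)
    case (Suc j)
    then obtain c where "(a, c) \<in> R Z TM h ^^ j" "(c, b) \<in> R Z TM h" by auto
    then show ?case using Suc.IH[of c] R_iff[of c b] by auto
  qed simp
  show "\<exists>b<2 ^ dim. set_of (mem b) = B \<and> (a, b) \<in> R Z TM h ^^ j"
    if "(A, B) \<in> frozen_move Z TM h ^^ j" "a < 2 ^ dim" "set_of (mem a) = A"
    using that
  proof (induction j arbitrary: B)
    case (Suc j)
    then obtain C where C: "(A, C) \<in> frozen_move Z TM h ^^ j" "(C, B) \<in> frozen_move Z TM h" by auto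
    obtain c where c: "c < 2 ^ dim" "set_of (mem c) = C" "(a, c) \<in> R Z TM h ^^ j"
      using Suc.IH[OF C(1)] Suc.prems by auto
    have "frozen B" using C by (simp add: frozen_move_def)
    then obtain b where b: "b < 2 ^ dim" "set_of (mem b) = B" by (rule frozen_code)
    have "(c, b) \<in> R Z TM h" using R_iff[of c b] b c C by simp
    then show ?case using b c by auto
  qed auto
qed

lemma search_iff:
  "search Z TM n E h s t (2 ^ dim) mem r \<longleftrightarrow>
    (\<exists>j\<le>r. \<exists>a<2 ^ dim. \<exists>b<2 ^ dim. admissible Z TM h (set_of s) \<and>
      set_of (mem a) = set_of s \<and> set_of (mem b) = set_of t \<and>
      (a, b) \<in> {(a, b). a < 2 ^ dim \<and> b < 2 ^ dim \<and>
        valid_fm Z TM n E h (mem b) \<and> step_fm TM n E (mem a) (mem b)} ^^ j)"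
proof -
  have eq: "(\<forall>v<n. mem a v \<longleftrightarrow> P v) \<longleftrightarrow> set_of (mem a) = set_of P" for a P by auto
  have init: "valid_fm Z TM n E h (mem a) \<and> set_of (mem a) = set_of s \<longleftrightarrow>
      admissible Z TM h (set_of s) \<and> set_of (mem a) = set_of s" for a
    by (metis admissible_set_of)
  let ?I = "\<lambda>a. admissible Z TM h (set_of s) \<and> set_of (mem a) = set_of s"
  let ?Q = "\<lambda>a b. valid_fm Z TM n E h (mem b) \<and> step_fm TM n E (mem a) (mem b)"
  have "search Z TM n E h s t (2 ^ dim) mem r \<longleftrightarrow>
      (\<exists>b<2 ^ dim. elt (2 ^ dim) (reach_code (2 ^ dim) ?I ?Q r) b \<and> set_of (mem b) = set_of t)"
    unfolding search_def eq init ..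
  also have "\<dots> \<longleftrightarrow> (\<exists>b<2 ^ dim. (\<exists>j\<le>r. \<exists>a<2 ^ dim. ?I a \<and>
      (a, b) \<in> {(a, b). a < 2 ^ dim \<and> b < 2 ^ dim \<and> ?Q a b} ^^ j) \<and> set_of (mem b) = set_of t)"
    using elt_reach_code[of _ "2 ^ dim" ?I ?Q r] by (intro ex_cong1 conj_cong refl) simp_all
  finally show ?thesis by blast
qed

lemma frozen_src: "frozen (set_of s)"
  by (auto simp: frozen_def)


lemma search_complete:
  assumes "(set_of s, set_of t) \<in> frozen_move Z TM h ^^ j" "admissible Z TM h (set_of s)"
    and "min j (2 ^ dim * 2 ^ dim) \<le> r"
  shows "search Z TM n E h s t (2 ^ dim) mem r"
proof -
  obtain a where a: "a < 2 ^ dim" "set_of (mem a) = set_of s" using frozen_code[OF frozen_src] .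
  obtain b where b: "b < 2 ^ dim" "set_of (mem b) = set_of t"
    and ab: "(a, b) \<in> {(a, b). a < 2 ^ dim \<and> b < 2 ^ dim \<and>
        valid_fm Z TM n E h (mem b) \<and> step_fm TM n E (mem a) (mem b)} ^^ j"
    using frozen_relpow_codes(2)[OF assms(1) a] by blast
  obtain i where i: "i \<le> min j (2 ^ dim * 2 ^ dim)" "(a, b) \<in> {(a, b). a < 2 ^ dim \<and> b < 2 ^ dim \<and>
        valid_fm Z TM n E h (mem b) \<and> step_fm TM n E (mem a) (mem b)} ^^ i"
    using relpow_bounded_below[OF ab, of "2 ^ dim"] by auto
  have "i \<le> r" using i(1) assms(3) by (rule order_trans)
  then show ?thesis
    unfolding search_iff using a b assms(2) i(2)
    by (intro exI[of _ i] exI[of _ a] exI[of _ b] conjI)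
qed

lemma search_sound:
  assumes "search Z TM n E h s t (2 ^ dim) mem r"
  obtains j where "j \<le> r" "(set_of s, set_of t) \<in> frozen_move Z TM h ^^ j" "admissible Z TM h (set_of s)"
proof -
  obtain j a b where *: "j \<le> r" "admissible Z TM h (set_of s)"
      "set_of (mem a) = set_of s" "set_of (mem b) = set_of t"
      "(a, b) \<in> {(a, b). a < 2 ^ dim \<and> b < 2 ^ dim \<and>
        valid_fm Z TM n E h (mem b) \<and> step_fm TM n E (mem a) (mem b)} ^^ j"
    using assms unfolding search_iff by (elim exE conjE)
  with frozen_relpow_codes(1)[OF *(5)] show thesis by (intro that) simp_all
qed

theorem search_reconf:
  assumes param: "timed \<and> l \<le> k \<or> (if TM = TAR then h else card (set_of s)) \<le> k"
    and r: "r = (if timed then min (l - 1) (2 ^ dim * 2 ^ dim) else 2 ^ dim * 2 ^ dim)"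
  shows "(\<exists>xs. reconf_seq Z TM V E h (set_of s) (set_of t) xs \<and> (timed \<longrightarrow> length xs \<le> l)) \<longleftrightarrow>
    (timed \<longrightarrow> 0 < l) \<and> search Z TM n E h s t (2 ^ dim) mem r"
proof
  assume "\<exists>xs. reconf_seq Z TM V E h (set_of s) (set_of t) xs \<and> (timed \<longrightarrow> length xs \<le> l)"
  then obtain xs where xs: "reconf_seq Z TM V E h (set_of s) (set_of t) xs" "timed \<longrightarrow> length xs \<le> l"
    by blast
  then obtain j where j: "length xs = Suc j" by (cases xs) (auto simp: reconf_seq_def)
  have path: "admissible Z TM h (set_of s)" "(set_of s, set_of t) \<in> move Z TM h ^^ j"
    using reconf_seq_relpow[of Z TM h "set_of s" "set_of t" j] xs j by blast+
  \<comment> \<open>In the timed case \<open>Suc j = length xs \<le> l \<le> k\<close>; under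
    addition and removal, admissibility of the start set bounds its size by
    \<open>h\<close>.\<close>
  have "j < k \<or> card (set_of s) \<le> k \<and> (TM = TAR \<longrightarrow> h \<le> k)"
    using param xs(2) j path(1) by (auto simp: admissible_def split: if_splits)
  from canon_path[OF path(2,1) order_refl this]
  obtain i where i: "i \<le> j" "(set_of s, set_of t) \<in> frozen_move Z TM h ^^ i"
    by (auto simp: canon_tgt)
  have "min i (2 ^ dim * 2 ^ dim) \<le> r"
    using i(1) xs(2) j r by (cases timed) auto
  with search_complete[OF i(2) path(1)] xs(2) j
  show "(timed \<longrightarrow> 0 < l) \<and> search Z TM n E h s t (2 ^ dim) mem r" by auto
next
  assume "(timed \<longrightarrow> 0 < l) \<and> search Z TM n E h s t (2 ^ dim) mem r"
  then have l: "timed \<longrightarrow> 0 < l" and "search Z TM n E h s t (2 ^ dim) mem r" by auto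
  from this(2) obtain j where j: "j \<le> r" "(set_of s, set_of t) \<in> frozen_move Z TM h ^^ j"
    "admissible Z TM h (set_of s)" by (rule search_sound)
  have "(A, B) \<in> move Z TM h ^^ i" if "(A, B) \<in> frozen_move Z TM h ^^ i" for A B i
    using that by (induction i arbitrary: B) (auto simp: frozen_move_def)
  then have "(set_of s, set_of t) \<in> move Z TM h ^^ j" using j(2) .
  then obtain xs where "reconf_seq Z TM V E h (set_of s) (set_of t) xs" "length xs = Suc j"
    using reconf_seq_relpow[of Z TM h "set_of s" "set_of t" j] j(3) by blast
  moreover have "timed \<longrightarrow> Suc j \<le> l" using j(1) r l by auto
  ultimately show "\<exists>xs. reconf_seq Z TM V E h (set_of s) (set_of t) xs \<and> (timed \<longrightarrow> length xs \<le> l)"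
    by auto
qed

end

section \<open>From the bound on the state space to fixed-parameter running time\<close>

section \<open>The main theorem\<close>

lemma answer_correct:
  assumes x: "x \<in> instances" and p: "p = Length \<Longrightarrow> timed"
  shows "answer Z TM timed p (memory (reconf_enc TM timed x)) \<longleftrightarrow> reconf_yes Z TM timed x"
proof -
  define M where "M = memory (reconf_enc TM timed x)"
  let ?s = "\<lambda>v. v \<in> src x" and ?t = "\<lambda>v. v \<in> tgt x"
  have M: "the_order M = order x" "the_src M = ?s" "the_tgt M = ?t" "the_adj M = adj x"
      "TM = TAR \<Longrightarrow> the_thr M = thr x" "timed \<Longrightarrow> the_len TM M = len x" "the_par TM p M = par_val TM p x"
    unfolding M_def fun_eq_iff
    by (simp_all add: x p the_order_memory the_src_memory the_tgt_memory the_adj_memory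
        the_thr_memory the_len_memory the_par_memory)
  interpret reconf_graph "order x" "adj x" ?s ?t "par_val TM p x"
    by unfold_locales (use x in \<open>simp add: instances_def\<close>)
  have st: "set_of ?s = src x" "set_of ?t = tgt x" using x by (auto simp: instances_def)
  \<comment> \<open>The word carries a threshold only for \<open>TAR\<close>; for the other models
    \<open>valid_fm\<close> does not consult it.\<close>
  have thr: "valid_fm Z TM (order x) (adj x) (the_thr M) A \<longleftrightarrow> valid_fm Z TM (order x) (adj x) (thr x) A" for A
    using M by (auto simp: valid_fm_def)
  let ?r = "if timed then min (len x - 1) (2 ^ dim * 2 ^ dim) else 2 ^ dim * 2 ^ dim"
  have "answer Z TM timed p M \<longleftrightarrow> (timed \<longrightarrow> 0 < len x) \<and>
      search Z TM (order x) (adj x) (thr x) ?s ?t (2 ^ dim) mem ?r"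
    using M(6) unfolding answer_def search_def M(1-4,7) thr by (cases timed) simp_all
  also have "\<dots> \<longleftrightarrow> reconf_yes Z TM timed x"
    unfolding reconf_yes_def
    by (subst search_reconf[where l = "len x" and timed = timed, symmetric])
      (use p in \<open>cases p; auto simp: st\<close>)+
  finally show ?thesis by (simp add: M_def)
qed

lemma computable_bound: "computable (\<lambda>\<kappa>. 2 ^ ((8 * (\<kappa> * \<kappa>) + 2) * c))"
proof -
  let ?f = "\<lambda>\<kappa>. 2 ^ ((8 * (\<kappa> * \<kappa>) + 2) * c) :: nat"
  \<comment> \<open>Computability sets no time limit, so the measure simply dominates all loop
    lengths that occur in evaluating the bound.\<close>
  define G where "G M = ?f (M 0) + (8 * (M 0 * M 0) + 2) * c + M 0 * M 0 + M 0" for M :: "nat \<Rightarrow> nat"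
  have "polytime G (\<lambda>M e. ?f (M 0))"
    by (intro polytime_pow2 polytime_mult polytime_add polytime_const polytime_read bnd_const)
      (auto intro!: bndI simp: G_def)
  then obtain P d where P: "\<And>M t. small M \<Longrightarrow> (G M + 2) ^ d \<le> t \<Longrightarrow> halts_within P (0, M) t (?f (M 0))"
    by (rule polytime_program) blast
  have "halts_within P (0, (\<lambda>_. 0)(0 := \<kappa>)) ((G ((\<lambda>_. 0)(0 := \<kappa>)) + 2) ^ d) (?f \<kappa>)" for \<kappa>
    using P[of "(\<lambda>_. 0)(0 := \<kappa>)"] by (simp add: small_def)
  then show ?thesis unfolding computable_def by blast
qed

theorem theorem10:
  fixes TM :: token_model and Z :: alliance and p :: par and timed :: bool
  assumes "p = Length \<Longrightarrow> timed"
  shows "fpt instances (reconf_enc TM timed) (reconf_yes Z TM timed)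
           (\<lambda>x. nd {..<order x} (adj x) + par_val TM p x)"
proof -
  obtain P c where P: "\<And>M t. small M \<Longrightarrow> (space TM p M + 2) ^ c \<le> t \<Longrightarrow>
      halts_within P (0, M) t (of_bool (answer Z TM timed p M))"
    using polytime_program[OF polytimeB_answer_space[unfolded polytimeB_def]] by metis
  let ?f = "\<lambda>\<kappa>. 2 ^ ((8 * (\<kappa> * \<kappa>) + 2) * c) :: nat"
  have "halts_within P (input (reconf_enc TM timed x))
      (?f (nd {..<order x} (adj x) + par_val TM p x) * length (reconf_enc TM timed x) ^ c)
      (if reconf_yes Z TM timed x then 1 else 0)" if x: "x \<in> instances" for x
  proof -
    define w where "w = reconf_enc TM timed x"
    define \<kappa> where "\<kappa> = nd {..<order x} (adj x) + par_val TM p x"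
    interpret reconf_graph "order x" "adj x" "\<lambda>v. v \<in> src x" "\<lambda>v. v \<in> tgt x" "par_val TM p x"
      by unfold_locales (use x in \<open>simp add: instances_def\<close>)
    have "the_src (memory w) = (\<lambda>v. v \<in> src x)" "the_tgt (memory w) = (\<lambda>v. v \<in> tgt x)"
        "the_adj (memory w) = adj x" "the_order (memory w) = order x"
        "the_par TM p (memory w) = par_val TM p x"
      unfolding w_def fun_eq_iff
      by (simp_all add: x assms the_order_memory the_src_memory the_tgt_memory the_adj_memory the_par_memory)
    then have "the_dim TM p (memory w) = dim" by simp
    moreover have "dim \<le> 8 * (\<kappa> * \<kappa>)"
    proof -
      \<comment> \<open>Turns the product in \<open>dim_le\<close> into a function of the sum that
        serves as parameter.\<close>
      have "nd V (adj x) * par_val TM p x \<le> \<kappa> * \<kappa>" by (intro mult_le_mono) (simp_all add: \<kappa>_def)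
      then show ?thesis using dim_le by linarith
    qed
    ultimately have "2 ^ the_dim TM p (memory w) \<le> (2 ^ (8 * (\<kappa> * \<kappa>)) :: nat)"
      by simp
    moreover have L: "2 \<le> length w" using length_word[OF x] by (simp add: w_def)
    \<comment> \<open>Separates word length and parameter into factors; the factor 4 becomes the
      \<open>+ 2\<close> in the exponent of the bound.\<close>
    moreover have "l + u + 2 \<le> 4 * v * l" if "2 \<le> l" "u \<le> v" "1 \<le> v" for l u v :: nat
    proof -
      have "l * 1 \<le> l * v" "2 * v \<le> l * v" using that by (intro mult_le_mono; simp)+
      moreover have "4 * v * l = 4 * (l * v)" by simp
      ultimately show ?thesis using that by linarith
    qed
    ultimately have "space TM p (memory w) + 2 \<le> 4 * 2 ^ (8 * (\<kappa> * \<kappa>)) * length w"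
      unfolding space_def memory_0 by simp
    then have "(space TM p (memory w) + 2) ^ c \<le> (4 * 2 ^ (8 * (\<kappa> * \<kappa>)) * length w) ^ c"
      by (rule power_mono) simp
    also have "4 * 2 ^ (8 * (\<kappa> * \<kappa>)) = (2 ^ (8 * (\<kappa> * \<kappa>) + 2) :: nat)" by (simp add: power_add)
    also have "(2 ^ (8 * (\<kappa> * \<kappa>) + 2) * length w) ^ c = ?f \<kappa> * length w ^ c"
      by (simp only: power_mult_distrib power_mult)
    finally have "halts_within P (0, memory w) (?f \<kappa> * length w ^ c)
        (of_bool (answer Z TM timed p (memory w)))"
      by (rule P[OF small_memory])
    moreover have "input w = (0, memory w)" by (simp add: input_def)
    ultimately show ?thesis
      using answer_correct[OF x assms] by (simp add: w_def \<kappa>_def of_bool_def)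
  qed
  then show ?thesis
    unfolding fpt_def using computable_bound[of c] by blast
qed

end
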